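(* Let $n\in\{0,1,2\}$, $\gamma>1$, and let $S=S(s)>0$ be a smooth function on an interval. Consider the partial differential equation for $\varphi(t,s)$ $$\varphi_{tt}+\varphi^{n(1-\gamma)}\varphi_s^{-\gamma}\Big(S'-n\gamma S\frac{\varphi_s}{\varphi}-\gamma S\frac{\varphi_{ss}}{\varphi_s}\Big)=0 .\qquad (\ast)$$ The Lie algebra of point symmetries (generators $\xi^t(t,s,\varphi)\partial_t+\xi^s(t,s,\varphi)\partial_s+\eta^\varphi(t,s,\varphi)\partial_\varphi$) admitted by $(\ast)$ consists exactly of the vector fields $X=\sum_{i=1}^8k_iY_i$, where $$Y_1=\partial_t,\quad Y_2=\partial_s,\quad Y_3=\partial_\varphi,\quad Y_4=t\partial_t,\quad Y_5=s\partial_s,\quad Y_6=\varphi\partial_\varphi,\quad Y_7=t\partial_\varphi,\quad Y_8=t^2\partial_t+t\varphi\partial_\varphi,$$ and the constants $k_1,\dots,k_8$ satisfy $$(k_5s+k_2)S'(s)=\big(-2k_4+(1-\gamma)k_5+((n+1)\gamma-n+1)k_6\big)S(s)\quad\text{for all } s,$$ $$((n+1)\gamma-n-3)k_8=0,\qquad nk_3=0,\qquad nk_7=0 .$$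
   Context: Equation $(\ast)$ is the gas dynamics equation of one-dimensional flows of a polytropic gas in mass Lagrangian coordinates $(t,s)$; $n=0,1,2$ corresponds to plane, radially symmetric and spherically symmetric flows. Here $\varphi_s>0$, and $\varphi>0$ when $n\ge1$. A vector field is an admitted point symmetry if its second prolongation annihilates the left-hand side of $(\ast)$ on the manifold in jet space defined by $(\ast)$. *)

theory Defs
  imports "HOL-Analysis.Analysis"
begin

text \<open>Used on open sets only, where the derivatives ``at x'' involve no boundary points.\<close>

primrec C_k_on ::
  "nat \<Rightarrow> 'a::real_normed_vector set \<Rightarrow> ('a \<Rightarrow> 'b::real_normed_vector) \<Rightarrow> bool" where
  "C_k_on 0 A f \<longleftrightarrow> continuous_on A f"
| "C_k_on (Suc k) A f \<longleftrightarrow>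
     (\<forall>x\<in>A. f differentiable (at x)) \<and>
     (\<forall>v. C_k_on k A (\<lambda>x. frechet_derivative f (at x) v))"

definition smooth_on ::
  "'a::real_normed_vector set \<Rightarrow> ('a \<Rightarrow> 'b::real_normed_vector) \<Rightarrow> bool" where
  "smooth_on A f \<longleftrightarrow> (\<forall>k. C_k_on k A f)"


text \<open>
  Second-order jet space of functions \<open>\<phi>(t, s)\<close>: the coordinates are
  \<open>t, s, \<phi>, \<phi>\<^sub>t, \<phi>\<^sub>s, \<phi>\<^sub>t\<^sub>t, \<phi>\<^sub>t\<^sub>s, \<phi>\<^sub>s\<^sub>s\<close>.
\<close>

record jet =
  jt :: real
  js :: real
  u :: real
  u_t :: real
  u_s :: real
  u_tt :: real
  u_ts :: real
  u_ss :: real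

definition base :: "jet \<Rightarrow> real \<times> real \<times> real" where
  "base z = (jt z, js z, u z)"

text \<open>
  \<open>pd c_update F\<close> is the partial derivative of \<open>F\<close> with respect to the jet coordinate \<open>c\<close>,
  all coordinates being treated as independent variables.
\<close>

definition pd :: "((real \<Rightarrow> real) \<Rightarrow> jet \<Rightarrow> jet) \<Rightarrow> (jet \<Rightarrow> real) \<Rightarrow> jet \<Rightarrow> real" where
  "pd upd F z = deriv (\<lambda>h. F (upd (\<lambda>x. x + h) z)) 0"

text \<open>
  Total derivatives. The sums are cut off after the first-order coordinates, so they are
  the total derivatives only of functions \<open>F\<close> that do not depend on
  \<open>u_tt, u_ts, u_ss\<close>; the second prolongation needs no others.
\<close>

definition D_t :: "(jet \<Rightarrow> real) \<Rightarrow> jet \<Rightarrow> real" where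
  "D_t F z = pd jt_update F z + u_t z * pd u_update F z
     + u_tt z * pd u_t_update F z + u_ts z * pd u_s_update F z"

definition D_s :: "(jet \<Rightarrow> real) \<Rightarrow> jet \<Rightarrow> real" where
  "D_s F z = pd js_update F z + u_s z * pd u_update F z
     + u_ts z * pd u_t_update F z + u_ss z * pd u_s_update F z"


text \<open>
  A vector field \<open>\<xi>\<^sup>t \<partial>\<^sub>t + \<xi>\<^sup>s \<partial>\<^sub>s + \<eta> \<partial>\<^sub>\<phi>\<close> is the map sending
  \<open>(t, s, \<phi>)\<close> to \<open>(\<xi>\<^sup>t, \<xi>\<^sup>s, \<eta>)\<close>.
\<close>

type_synonym vfield = "real \<times> real \<times> real \<Rightarrow> real \<times> real \<times> real"

definition xi_t :: "vfield \<Rightarrow> jet \<Rightarrow> real" where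
  "xi_t X z = fst (X (base z))"

definition xi_s :: "vfield \<Rightarrow> jet \<Rightarrow> real" where
  "xi_s X z = fst (snd (X (base z)))"

definition eta :: "vfield \<Rightarrow> jet \<Rightarrow> real" where
  "eta X z = snd (snd (X (base z)))"

definition eta_t :: "vfield \<Rightarrow> jet \<Rightarrow> real" where
  "eta_t X z = D_t (eta X) z - u_t z * D_t (xi_t X) z - u_s z * D_t (xi_s X) z"

definition eta_s :: "vfield \<Rightarrow> jet \<Rightarrow> real" where
  "eta_s X z = D_s (eta X) z - u_t z * D_s (xi_t X) z - u_s z * D_s (xi_s X) z"

definition eta_tt :: "vfield \<Rightarrow> jet \<Rightarrow> real" where
  "eta_tt X z = D_t (eta_t X) z - u_tt z * D_t (xi_t X) z - u_ts z * D_t (xi_s X) z"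

definition eta_ts :: "vfield \<Rightarrow> jet \<Rightarrow> real" where
  "eta_ts X z = D_s (eta_t X) z - u_tt z * D_s (xi_t X) z - u_ts z * D_s (xi_s X) z"

definition eta_ss :: "vfield \<Rightarrow> jet \<Rightarrow> real" where
  "eta_ss X z = D_s (eta_s X) z - u_ts z * D_s (xi_t X) z - u_ss z * D_s (xi_s X) z"

definition prolong2 :: "vfield \<Rightarrow> (jet \<Rightarrow> real) \<Rightarrow> jet \<Rightarrow> real" where
  "prolong2 X F z =
     xi_t X z * pd jt_update F z + xi_s X z * pd js_update F z + eta X z * pd u_update F z
     + eta_t X z * pd u_t_update F z + eta_s X z * pd u_s_update F z
     + eta_tt X z * pd u_tt_update F z + eta_ts X z * pd u_ts_update F z
     + eta_ss X z * pd u_ss_update F z"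

text \<open>
  \<open>D\<close> is the domain of the vector field in \<open>(t, s, \<phi>)\<close>-space;
  only jets with \<open>\<phi>\<^sub>s > 0\<close> are considered.
\<close>

definition admitted_point_symmetry ::
  "(real \<times> real \<times> real) set \<Rightarrow> (jet \<Rightarrow> real) \<Rightarrow> vfield \<Rightarrow> bool" where
  "admitted_point_symmetry D F X \<longleftrightarrow>
     smooth_on D X \<and>
     (\<forall>z. base z \<in> D \<and> u_s z > 0 \<and> F z = 0 \<longrightarrow> prolong2 X F z = 0)"


text \<open>
  The factor \<open>\<phi>\<close> to the power \<open>n(1-\<gamma>)\<close> is written as \<open>(\<phi>^n) powr (1-\<gamma>)\<close>:
  for \<open>n = 0\<close> it has to be 1 for every real \<open>\<phi>\<close>, but \<open>0 powr 0 = 0\<close>.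
  Likewise the term with \<open>\<phi>\<^sub>s/\<phi>\<close> vanishes for \<open>n = 0\<close>, also at \<open>\<phi> = 0\<close>.
\<close>

definition gas_dynamics :: "nat \<Rightarrow> real \<Rightarrow> (real \<Rightarrow> real) \<Rightarrow> jet \<Rightarrow> real" where
  "gas_dynamics n \<gamma> S z =
     u_tt z + (u z ^ n) powr (1 - \<gamma>) * u_s z powr (- \<gamma>) *
       (deriv S (js z) - real n * \<gamma> * S (js z) * (u_s z / u z)
        - \<gamma> * S (js z) * (u_ss z / u_s z))"

definition Y :: "nat \<Rightarrow> vfield" where
  "Y i = (\<lambda>(t, s, \<phi>).
     [(1, 0, 0), (0, 1, 0), (0, 0, 1), (t, 0, 0), (0, s, 0), (0, 0, \<phi>),
      (0, 0, t), (t\<^sup>2, 0, t * \<phi>)] ! (i - 1))"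

end

theory Submission
  imports Defs
begin

text \<open>
  On solutions, the prolonged equation is a polynomial in \<open>\<phi>\<^sub>t, \<phi>\<^sub>t\<^sub>s, \<phi>\<^sub>s\<^sub>s\<close> whose coefficients are
  combinations of powers of \<open>\<phi>\<^sub>s\<close> with distinct real exponents, so it splits. The coefficient of
  \<open>\<phi>\<^sub>t\<^sub>s\<close> makes \<open>\<xi>\<^sup>t\<close> a function \<open>\<tau>(t)\<close> and \<open>\<xi>\<^sup>s\<close> a function \<open>\<sigma>(s)\<close>. The other ones then force
  the \<open>s\<close>-derivative and the second \<open>t\<close>- and \<open>\<phi>\<close>-derivatives of \<open>\<eta>\<close> to vanish, so that \<open>\<eta>\<close> is affine
  in \<open>t\<close> and in \<open>\<phi>\<close>, and \<open>\<tau>\<close> to be quadratic. Two equations for \<open>S\<close> remain; one of them minus the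
  derivative of the other is \<open>S \<sigma>'' = 0\<close>.

  After every step the prolongation formula is applied anew to the simplified form of the vector
  field, so that the symmetry of mixed partial derivatives is never needed.
\<close>

section \<open>Partial and total derivatives\<close>

text \<open>Smoothness here concerns iterated directional derivatives. It provides a derivative
  \<open>\<eta>'' vu vs\<close> of \<open>\<eta>' vu\<close>, but nothing relates it to
  \<open>\<eta>'' vs vu\<close>; so \<open>\<eta>' vs = 0\<close> does not by itself remove it from
  the prolongation. Hence, once a component of the field is known not to depend on a variable, that
  variable is frozen at a point of the box, and the new derivative data contain literal zeros in
  both orders.

  Origin of the conditions on the constants: let a be the \<phi>-derivative of \<eta> and N =
  (n+1)\<gamma> - n + 1. The coefficient of \<open>u_ss\<close> contains n \<eta> / \<phi>; for n >
  0 the part of \<eta> free of \<phi> would leave a term in 1/\<phi>, hence n k3 = n k7 = 0. Then n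
  \<eta> / \<phi> = n a, and the coefficient says \<sigma> S' = (-2 \<tau>' + N a + (1-\<gamma>)
  \<sigma>') S. With a = k6 + k8 t and \<tau>' = k4 + 2 k8 t the right side contains t only in (N -
  4) k8 t, and N - 4 = (n+1)\<gamma> - n - 3 is the factor in the condition on k8.\<close>

datatype var = vt | vs | vu

text \<open>A relation and not an operator, so that a family in a convenient form, for instance with
  literal zeros, can serve as derivative data. Its values off \<open>D\<close> are
  arbitrary.\<close>

definition partials :: "(real \<times> real \<times> real) set \<Rightarrow> (real \<times> real \<times> real \<Rightarrow> real) \<Rightarrow>
    (var \<Rightarrow> real \<times> real \<times> real \<Rightarrow> real) \<Rightarrow> bool" where
  "partials D f f' \<longleftrightarrow> (\<forall>p\<in>D. (f has_derivative
     (\<lambda>h. fst h * f' vt p + fst (snd h) * f' vs p + snd (snd h) * f' vu p)) (at p))"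

text \<open>\<open>f'' v w\<close> is the derivative of \<open>f' v\<close> with respect to \<open>w\<close>.\<close>

definition partials2 :: "(real \<times> real \<times> real) set \<Rightarrow> (real \<times> real \<times> real \<Rightarrow> real) \<Rightarrow>
    (var \<Rightarrow> real \<times> real \<times> real \<Rightarrow> real) \<Rightarrow> (var \<Rightarrow> var \<Rightarrow> real \<times> real \<times> real \<Rightarrow> real) \<Rightarrow> bool" where
  "partials2 D f f' f'' \<longleftrightarrow> partials D f f' \<and> (\<forall>v. partials D (f' v) (f'' v))"

lemma partials_DERIV:
  assumes "partials D g g'" "(t, s, x) \<in> D"
  shows "((\<lambda>r. g (r, s, x)) has_real_derivative g' vt (t, s, x)) (at t)"
    and "((\<lambda>r. g (t, r, x)) has_real_derivative g' vs (t, s, x)) (at s)"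
    and "((\<lambda>r. g (t, s, r)) has_real_derivative g' vu (t, s, x)) (at x)"
proof -
  have d: "(g has_derivative (\<lambda>h. fst h * g' vt (t, s, x) + fst (snd h) * g' vs (t, s, x)
      + snd (snd h) * g' vu (t, s, x))) (at (t, s, x))"
    using assms by (auto simp: partials_def)
  have *: "((\<lambda>r. g (c r)) has_derivative (\<lambda>h. fst (c' h) * g' vt (t, s, x) + fst (snd (c' h)) * g' vs (t, s, x)
      + snd (snd (c' h)) * g' vu (t, s, x))) (at r)"
    if "(c has_derivative c') (at r)" "c r = (t, s, x)" for c c' and r :: real
    using has_derivative_compose[OF that(1), of g] d that(2) by simp
  show "((\<lambda>r. g (r, s, x)) has_real_derivative g' vt (t, s, x)) (at t)"
    using *[OF has_derivative_Pair[OF has_derivative_ident has_derivative_const[of "(s, x)"]]]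
    by (simp add: has_field_derivative_def mult.commute[of _ "g' _ _"])
  show "((\<lambda>r. g (t, r, x)) has_real_derivative g' vs (t, s, x)) (at s)"
    using *[OF has_derivative_Pair[OF has_derivative_const[of t] has_derivative_Pair[OF has_derivative_ident has_derivative_const[of x]]]]
    by (simp add: has_field_derivative_def mult.commute[of _ "g' _ _"])
  show "((\<lambda>r. g (t, s, r)) has_real_derivative g' vu (t, s, x)) (at x)"
    using *[OF has_derivative_Pair[OF has_derivative_const[of t] has_derivative_Pair[OF has_derivative_const[of s] has_derivative_ident]]]
    by (simp add: has_field_derivative_def mult.commute[of _ "g' _ _"])
qed

text \<open>
  \<open>a\<close> and \<open>b\<close> are \<open>D_t F z\<close> and \<open>D_s F z\<close>; the existence of the five partial derivatives is
  included because \<open>deriv\<close> is an arbitrary value where there is none.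
\<close>

definition has_total :: "(jet \<Rightarrow> real) \<Rightarrow> real \<Rightarrow> real \<Rightarrow> jet \<Rightarrow> bool" where
  "has_total F a b z \<longleftrightarrow> (\<exists>d1 d2 d3 d4 d5.
     ((\<lambda>h. F (jt_update (\<lambda>x. x + h) z)) has_real_derivative d1) (at 0) \<and>
     ((\<lambda>h. F (js_update (\<lambda>x. x + h) z)) has_real_derivative d2) (at 0) \<and>
     ((\<lambda>h. F (u_update (\<lambda>x. x + h) z)) has_real_derivative d3) (at 0) \<and>
     ((\<lambda>h. F (u_t_update (\<lambda>x. x + h) z)) has_real_derivative d4) (at 0) \<and>
     ((\<lambda>h. F (u_s_update (\<lambda>x. x + h) z)) has_real_derivative d5) (at 0) \<and>
     a = d1 + u_t z * d3 + u_tt z * d4 + u_ts z * d5 \<and>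
     b = d2 + u_s z * d3 + u_ts z * d4 + u_ss z * d5)"

lemma has_total_imp:
  assumes "has_total F a b z"
  shows "D_t F z = a" "D_s F z = b"
  using assms by (auto simp: has_total_def D_t_def D_s_def pd_def dest!: DERIV_imp_deriv)

lemma jet_update_zero [simp]:
  "jt_update (\<lambda>x. x) z = z" "js_update (\<lambda>x. x) z = z" "u_update (\<lambda>x. x) z = z"
  "u_t_update (\<lambda>x. x) z = z" "u_s_update (\<lambda>x. x) z = z"
  by simp_all

lemma has_total_base:
  assumes "partials D g g'" "base z \<in> D"
  shows "has_total (\<lambda>z. g (base z)) (g' vt (base z) + u_t z * g' vu (base z))
    (g' vs (base z) + u_s z * g' vu (base z)) z"
proof -
  have D: "(jt z, js z, u z) \<in> D" using assms(2) by (simp add: base_def)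
  note d = partials_DERIV[OF assms(1) D]
  have sh: "((\<lambda>h. f (c + h)) has_real_derivative l) (at 0)"
    if "(f has_real_derivative l) (at c)" for f :: "real \<Rightarrow> real" and c l
    using DERIV_shift[of f l 0 c] that by (simp add: add.commute)
  show ?thesis unfolding has_total_def
    using sh[OF d(1)] sh[OF d(2)] sh[OF d(3)]
    by (intro exI[of _ "g' vt (base z)"] exI[of _ "g' vs (base z)"] exI[of _ "g' vu (base z)"]
         exI[of _ 0]) (simp add: base_def)
qed

lemma has_total_u_t: "has_total u_t (u_tt z) (u_ts z) z"
  unfolding has_total_def
  by (rule exI[of _ 0], rule exI[of _ 0], rule exI[of _ 0], rule exI[of _ 1], rule exI[of _ 0])
     (auto intro!: derivative_eq_intros)

lemma has_total_u_s: "has_total u_s (u_ts z) (u_ss z) z"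
  unfolding has_total_def
  by (rule exI[of _ 0], rule exI[of _ 0], rule exI[of _ 0], rule exI[of _ 0], rule exI[of _ 1])
     (auto intro!: derivative_eq_intros)

lemma has_total_add:
  assumes "has_total F a b z" "has_total G c d z"
  shows "has_total (\<lambda>z. F z + G z) (a + c) (b + d) z"
proof -
  from assms(1) obtain d1 d2 d3 d4 d5 where 1:
    "((\<lambda>h. F (jt_update (\<lambda>x. x + h) z)) has_real_derivative d1) (at 0)"
    "((\<lambda>h. F (js_update (\<lambda>x. x + h) z)) has_real_derivative d2) (at 0)"
    "((\<lambda>h. F (u_update (\<lambda>x. x + h) z)) has_real_derivative d3) (at 0)"
    "((\<lambda>h. F (u_t_update (\<lambda>x. x + h) z)) has_real_derivative d4) (at 0)"
    "((\<lambda>h. F (u_s_update (\<lambda>x. x + h) z)) has_real_derivative d5) (at 0)"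
    "a = d1 + u_t z * d3 + u_tt z * d4 + u_ts z * d5"
    "b = d2 + u_s z * d3 + u_ts z * d4 + u_ss z * d5" unfolding has_total_def by blast
  from assms(2) obtain e1 e2 e3 e4 e5 where 2:
    "((\<lambda>h. G (jt_update (\<lambda>x. x + h) z)) has_real_derivative e1) (at 0)"
    "((\<lambda>h. G (js_update (\<lambda>x. x + h) z)) has_real_derivative e2) (at 0)"
    "((\<lambda>h. G (u_update (\<lambda>x. x + h) z)) has_real_derivative e3) (at 0)"
    "((\<lambda>h. G (u_t_update (\<lambda>x. x + h) z)) has_real_derivative e4) (at 0)"
    "((\<lambda>h. G (u_s_update (\<lambda>x. x + h) z)) has_real_derivative e5) (at 0)"
    "c = e1 + u_t z * e3 + u_tt z * e4 + u_ts z * e5"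
    "d = e2 + u_s z * e3 + u_ts z * e4 + u_ss z * e5" unfolding has_total_def by blast
  show ?thesis unfolding has_total_def
    by (intro exI conjI, (rule DERIV_add, rule 1, rule 2)+)
       (simp_all add: 1(6,7) 2(6,7) algebra_simps)
qed

lemma has_total_mult:
  assumes "has_total F a b z" "has_total G c d z"
  shows "has_total (\<lambda>z. F z * G z) (a * G z + F z * c) (b * G z + F z * d) z"
proof -
  from assms(1) obtain d1 d2 d3 d4 d5 where 1:
    "((\<lambda>h. F (jt_update (\<lambda>x. x + h) z)) has_real_derivative d1) (at 0)"
    "((\<lambda>h. F (js_update (\<lambda>x. x + h) z)) has_real_derivative d2) (at 0)"
    "((\<lambda>h. F (u_update (\<lambda>x. x + h) z)) has_real_derivative d3) (at 0)"
    "((\<lambda>h. F (u_t_update (\<lambda>x. x + h) z)) has_real_derivative d4) (at 0)"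
    "((\<lambda>h. F (u_s_update (\<lambda>x. x + h) z)) has_real_derivative d5) (at 0)"
    "a = d1 + u_t z * d3 + u_tt z * d4 + u_ts z * d5"
    "b = d2 + u_s z * d3 + u_ts z * d4 + u_ss z * d5" unfolding has_total_def by blast
  from assms(2) obtain e1 e2 e3 e4 e5 where 2:
    "((\<lambda>h. G (jt_update (\<lambda>x. x + h) z)) has_real_derivative e1) (at 0)"
    "((\<lambda>h. G (js_update (\<lambda>x. x + h) z)) has_real_derivative e2) (at 0)"
    "((\<lambda>h. G (u_update (\<lambda>x. x + h) z)) has_real_derivative e3) (at 0)"
    "((\<lambda>h. G (u_t_update (\<lambda>x. x + h) z)) has_real_derivative e4) (at 0)"
    "((\<lambda>h. G (u_s_update (\<lambda>x. x + h) z)) has_real_derivative e5) (at 0)"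
    "c = e1 + u_t z * e3 + u_tt z * e4 + u_ts z * e5"
    "d = e2 + u_s z * e3 + u_ts z * e4 + u_ss z * e5" unfolding has_total_def by blast
  show ?thesis unfolding has_total_def
    by (intro exI conjI, (rule DERIV_mult, rule 1, rule 2)+)
       (simp_all add: 1(6,7) 2(6,7) algebra_simps)
qed

lemma has_total_minus:
  assumes "has_total F a b z"
  shows "has_total (\<lambda>z. - F z) (- a) (- b) z"
proof -
  have "has_total (\<lambda>z. - 1) 0 0 z"
    unfolding has_total_def
    by (rule exI[of _ 0], rule exI[of _ 0], rule exI[of _ 0], rule exI[of _ 0], rule exI[of _ 0])
       (auto intro!: derivative_eq_intros)
  from has_total_mult[OF this assms] show ?thesis by simp
qed

lemma has_total_diff:
  assumes "has_total F a b z" "has_total G c d z"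
  shows "has_total (\<lambda>z. F z - G z) (a - c) (b - d) z"
  using has_total_add[OF assms(1) has_total_minus[OF assms(2)]] by simp

lemma eventually_in_open_curve:
  fixes c :: "real \<Rightarrow> 'a::topological_space"
  assumes "isCont c 0" "open D" "c 0 \<in> D"
  shows "eventually (\<lambda>h. c h \<in> D) (nhds 0)"
  using assms topological_tendstoD[of c "c 0" "at 0" D]
  by (simp add: isCont_def eventually_nhds_conv_at)

text \<open>The five partial derivatives are taken along lines in jet space whose projections stay
  in the open set \<open>D\<close> for small h, so agreement over \<open>D\<close> is enough. This
  allows a formula for \<open>eta_t\<close> or \<open>eta_s\<close> that is known only over
  \<open>D\<close> to be differentiated again.\<close>

lemma has_total_cong:
  assumes "has_total G a b z" "\<And>w. base w \<in> D \<Longrightarrow> F w = G w" "open D" "base z \<in> D"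
  shows "has_total F a b z"
proof -
  have ev: "((\<lambda>h. F (c h)) has_real_derivative d) (at 0)"
    if "((\<lambda>h. G (c h)) has_real_derivative d) (at 0)" "isCont (\<lambda>h. base (c h)) 0" "base (c 0) \<in> D"
    for c d
  proof -
    have "eventually (\<lambda>h. base (c h) \<in> D) (nhds 0)"
      by (rule eventually_in_open_curve[OF that(2) assms(3) that(3)])
    then have "eventually (\<lambda>h. F (c h) = G (c h)) (nhds 0)"
      by (rule eventually_mono) (rule assms(2))
    then show ?thesis using that(1) DERIV_cong_ev[of "0::real" 0 "\<lambda>h. F (c h)" "\<lambda>h. G (c h)" d d] by simp
  qed
  from assms(1) obtain d1 d2 d3 d4 d5 where 1:
    "((\<lambda>h. G (jt_update (\<lambda>x. x + h) z)) has_real_derivative d1) (at 0)"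
    "((\<lambda>h. G (js_update (\<lambda>x. x + h) z)) has_real_derivative d2) (at 0)"
    "((\<lambda>h. G (u_update (\<lambda>x. x + h) z)) has_real_derivative d3) (at 0)"
    "((\<lambda>h. G (u_t_update (\<lambda>x. x + h) z)) has_real_derivative d4) (at 0)"
    "((\<lambda>h. G (u_s_update (\<lambda>x. x + h) z)) has_real_derivative d5) (at 0)"
    "a = d1 + u_t z * d3 + u_tt z * d4 + u_ts z * d5"
    "b = d2 + u_s z * d3 + u_ts z * d4 + u_ss z * d5" unfolding has_total_def by blast
  show ?thesis unfolding has_total_def
    apply (rule exI[of _ d1], rule exI[of _ d2], rule exI[of _ d3], rule exI[of _ d4], rule exI[of _ d5])
    using assms(4) by (intro conjI ev 1) (auto simp: base_def intro!: continuous_intros)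
qed

section \<open>The second prolongation\<close>

definition dt where "dt f' z = f' vt (base z) + u_t z * f' vu (base z)"
definition ds where "ds f' z = f' vs (base z) + u_s z * f' vu (base z)"

text \<open>The second total t-derivative of a function of (t, s, \<phi>). The two mixed partial
  derivatives are kept as a sum because they are not known to agree.\<close>

definition dtt where
  "dtt f' f'' z = f'' vt vt (base z) + u_t z * (f'' vt vu (base z) + f'' vu vt (base z))
     + (u_t z)\<^sup>2 * f'' vu vu (base z) + u_tt z * f' vu (base z)"

definition dss where
  "dss f' f'' z = f'' vs vs (base z) + u_s z * (f'' vs vu (base z) + f'' vu vs (base z))
     + (u_s z)\<^sup>2 * f'' vu vu (base z) + u_ss z * f' vu (base z)"

lemma has_total_dt:
  assumes "\<forall>v. partials D (f' v) (f'' v)" "base z \<in> D"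
  shows "\<exists>b. has_total (dt f') (dtt f' f'' z) b z"
proof -
  note h = has_total_base[OF assms(1)[rule_format] assms(2)]
  note k = has_total_add[OF h[of vt] has_total_mult[OF has_total_u_t h[of vu]]]
  have "dt f' = (\<lambda>z. f' vt (base z) + u_t z * f' vu (base z))" by (auto simp: dt_def)
  moreover have "dtt f' f'' z = f'' vt vt (base z) + u_t z * f'' vt vu (base z) +
     (u_tt z * f' vu (base z) + u_t z * (f'' vu vt (base z) + u_t z * f'' vu vu (base z)))"
    by (simp add: dtt_def algebra_simps power2_eq_square)
  ultimately show ?thesis using k by auto
qed

lemma has_total_ds:
  assumes "\<forall>v. partials D (f' v) (f'' v)" "base z \<in> D"
  shows "\<exists>a. has_total (ds f') a (dss f' f'' z) z"
proof -
  note h = has_total_base[OF assms(1)[rule_format] assms(2)]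
  note k = has_total_add[OF h[of vs] has_total_mult[OF has_total_u_s h[of vu]]]
  have "ds f' = (\<lambda>z. f' vs (base z) + u_s z * f' vu (base z))" by (auto simp: ds_def)
  moreover have "dss f' f'' z = f'' vs vs (base z) + u_s z * f'' vs vu (base z) +
     (u_ss z * f' vu (base z) + u_s z * (f'' vu vs (base z) + u_s z * f'' vu vu (base z)))"
    by (simp add: dss_def algebra_simps power2_eq_square)
  ultimately show ?thesis using k by auto
qed

locale prolongation =
  fixes D :: "(real \<times> real \<times> real) set" and X :: vfield
    and \<tau>' \<sigma>' \<eta>' :: "var \<Rightarrow> real \<times> real \<times> real \<Rightarrow> real"
    and \<tau>'' \<sigma>'' \<eta>'' :: "var \<Rightarrow> var \<Rightarrow> real \<times> real \<times> real \<Rightarrow> real"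
  assumes open_D: "open D"
    and partials_xi_t: "partials2 D (\<lambda>p. fst (X p)) \<tau>' \<tau>''"
    and partials_xi_s: "partials2 D (\<lambda>p. fst (snd (X p))) \<sigma>' \<sigma>''"
    and partials_eta: "partials2 D (\<lambda>p. snd (snd (X p))) \<eta>' \<eta>''"
begin

lemma totals:
  assumes "base z \<in> D"
  shows "D_t (xi_t X) z = dt \<tau>' z" "D_s (xi_t X) z = ds \<tau>' z"
    "D_t (xi_s X) z = dt \<sigma>' z" "D_s (xi_s X) z = ds \<sigma>' z"
    "D_t (eta X) z = dt \<eta>' z" "D_s (eta X) z = ds \<eta>' z"
proof -
  have e: "xi_t X = (\<lambda>z. fst (X (base z)))" "xi_s X = (\<lambda>z. fst (snd (X (base z))))"
    "eta X = (\<lambda>z. snd (snd (X (base z))))"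
    by (auto simp: xi_t_def xi_s_def eta_def)
  have p: "partials D (\<lambda>p. fst (X p)) \<tau>'" "partials D (\<lambda>p. fst (snd (X p))) \<sigma>'"
    "partials D (\<lambda>p. snd (snd (X p))) \<eta>'"
    using partials_xi_t partials_xi_s partials_eta by (auto simp: partials2_def)
  show "D_t (xi_t X) z = dt \<tau>' z" "D_s (xi_t X) z = ds \<tau>' z"
    using has_total_imp[OF has_total_base[OF p(1) assms]] by (auto simp: e dt_def ds_def)
  show "D_t (xi_s X) z = dt \<sigma>' z" "D_s (xi_s X) z = ds \<sigma>' z"
    using has_total_imp[OF has_total_base[OF p(2) assms]] by (auto simp: e dt_def ds_def)
  show "D_t (eta X) z = dt \<eta>' z" "D_s (eta X) z = ds \<eta>' z"
    using has_total_imp[OF has_total_base[OF p(3) assms]] by (auto simp: e dt_def ds_def)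
qed

lemma second_partials:
  "\<forall>v. partials D (\<tau>' v) (\<tau>'' v)" "\<forall>v. partials D (\<sigma>' v) (\<sigma>'' v)"
  "\<forall>v. partials D (\<eta>' v) (\<eta>'' v)"
  using partials_xi_t partials_xi_s partials_eta by (auto simp: partials2_def)

lemma eta_t_eq:
  "base z \<in> D \<Longrightarrow> eta_t X z = dt \<eta>' z - u_t z * dt \<tau>' z - u_s z * dt \<sigma>' z"
  by (simp add: eta_t_def totals)

lemma eta_s_eq:
  "base z \<in> D \<Longrightarrow> eta_s X z = ds \<eta>' z - u_t z * ds \<tau>' z - u_s z * ds \<sigma>' z"
  by (simp add: eta_s_def totals)

text \<open>The factors 2 arise because the product rule in \<open>D_t (eta_t X)\<close> yields
  \<open>u_tt z * dt \<tau>' z\<close> and \<open>u_ts z * dt \<sigma>' z\<close>, which the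
  definition of \<open>eta_tt\<close> subtracts once more.\<close>

lemma eta_tt_eq:
  assumes z: "base z \<in> D"
  shows "eta_tt X z = dtt \<eta>' \<eta>'' z - u_t z * dtt \<tau>' \<tau>'' z - u_s z * dtt \<sigma>' \<sigma>'' z
    - 2 * u_tt z * dt \<tau>' z - 2 * u_ts z * dt \<sigma>' z"
proof -
  obtain b1 b2 b3 where h: "has_total (dt \<eta>') (dtt \<eta>' \<eta>'' z) b1 z"
    "has_total (dt \<tau>') (dtt \<tau>' \<tau>'' z) b2 z" "has_total (dt \<sigma>') (dtt \<sigma>' \<sigma>'' z) b3 z"
    using second_partials[THEN has_total_dt, OF z] by blast
  have "\<exists>b. has_total (eta_t X) (dtt \<eta>' \<eta>'' z - (u_tt z * dt \<tau>' z + u_t z * dtt \<tau>' \<tau>'' z)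
    - (u_ts z * dt \<sigma>' z + u_s z * dtt \<sigma>' \<sigma>'' z)) b z"
    by (rule exI, rule has_total_cong[OF _ eta_t_eq open_D z])
      (rule has_total_diff has_total_mult has_total_u_t has_total_u_s h)+
  then have "D_t (eta_t X) z = dtt \<eta>' \<eta>'' z - (u_tt z * dt \<tau>' z + u_t z * dtt \<tau>' \<tau>'' z)
    - (u_ts z * dt \<sigma>' z + u_s z * dtt \<sigma>' \<sigma>'' z)"
    using has_total_imp by blast
  then show ?thesis by (simp add: eta_tt_def totals[OF z] algebra_simps)
qed

lemma eta_ss_eq:
  assumes z: "base z \<in> D"
  shows "eta_ss X z = dss \<eta>' \<eta>'' z - u_t z * dss \<tau>' \<tau>'' z - u_s z * dss \<sigma>' \<sigma>'' z
    - 2 * u_ts z * ds \<tau>' z - 2 * u_ss z * ds \<sigma>' z"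
proof -
  obtain b1 b2 b3 where h: "has_total (ds \<eta>') b1 (dss \<eta>' \<eta>'' z) z"
    "has_total (ds \<tau>') b2 (dss \<tau>' \<tau>'' z) z" "has_total (ds \<sigma>') b3 (dss \<sigma>' \<sigma>'' z) z"
    using second_partials[THEN has_total_ds, OF z] by blast
  have "\<exists>a. has_total (eta_s X) a (dss \<eta>' \<eta>'' z - (u_ts z * ds \<tau>' z + u_t z * dss \<tau>' \<tau>'' z)
    - (u_ss z * ds \<sigma>' z + u_s z * dss \<sigma>' \<sigma>'' z)) z"
    by (rule exI, rule has_total_cong[OF _ eta_s_eq open_D z])
      (rule has_total_diff has_total_mult has_total_u_t has_total_u_s h)+
  then have "D_s (eta_s X) z = dss \<eta>' \<eta>'' z - (u_ts z * ds \<tau>' z + u_t z * dss \<tau>' \<tau>'' z)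
    - (u_ss z * ds \<sigma>' z + u_s z * dss \<sigma>' \<sigma>'' z)"
    using has_total_imp by blast
  then show ?thesis by (simp add: eta_ss_def totals[OF z] algebra_simps)
qed

end

section \<open>The gas dynamics expression and its partial derivatives\<close>

definition gas_coeff :: "nat \<Rightarrow> real \<Rightarrow> jet \<Rightarrow> real" where
  "gas_coeff n \<gamma> z = (u z ^ n) powr (1 - \<gamma>) * u_s z powr (- \<gamma>)"

definition gas_bracket :: "nat \<Rightarrow> real \<Rightarrow> (real \<Rightarrow> real) \<Rightarrow> jet \<Rightarrow> real" where
  "gas_bracket n \<gamma> S z = deriv S (js z) - real n * \<gamma> * S (js z) * (u_s z / u z)
        - \<gamma> * S (js z) * (u_ss z / u_s z)"

lemma gas_dynamics_alt: "gas_dynamics n \<gamma> S z = u_tt z + gas_coeff n \<gamma> z * gas_bracket n \<gamma> S z"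
  by (simp add: gas_dynamics_def gas_coeff_def gas_bracket_def)

text \<open>For n = 0 the function is constantly 1, at x = 0 as well, and the claimed derivative is
  0 because its numerator is.\<close>

lemma DERIV_power_powr:
  fixes x c :: real
  assumes "n = 0 \<or> x > 0"
  shows "((\<lambda>h. ((x + h) ^ n) powr c) has_real_derivative real n * c / x * (x ^ n) powr c) (at 0)"
proof (cases "n = 0")
  case False
  then have x: "x > 0" using assms by simp
  have *: "((\<lambda>h. ((x + h) ^ n) powr c) has_real_derivative
     c * (x ^ n) powr (c - 1) * (real n * x ^ (n - 1))) (at 0)"
    using x by (auto intro!: derivative_eq_intros)
  have "(x ^ n) powr (c - 1) * x ^ (n - 1) = (x ^ n) powr c / x"
  proof -
    obtain m where "n = Suc m" using False by (cases n) auto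
    then show ?thesis using x by (simp add: powr_diff)
  qed
  then have "c * (x ^ n) powr (c - 1) * (real n * x ^ (n - 1)) = real n * c / x * (x ^ n) powr c"
    by (metis (no_types, opaque_lifting) mult.commute mult.left_commute times_divide_eq_left)
  then show ?thesis using *  by simp
qed simp

text \<open>Differentiating the power factor reproduces it, multiplied by n(1-\<gamma>)/u or by
  -\<gamma>/u_s. Hence \<open>gas_coeff\<close> factors out of all derivatives except the one in
  \<open>u_tt\<close>, which is 1.\<close>

lemma gas_pd:
  assumes S: "(S has_real_derivative deriv S (js z)) (at (js z))"
    "(deriv S has_real_derivative S2) (at (js z))"
    and "u_s z > 0" "n = 0 \<or> u z > 0"
  shows "pd jt_update (gas_dynamics n \<gamma> S) z = 0"
    and "pd u_t_update (gas_dynamics n \<gamma> S) z = 0"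
    and "pd u_tt_update (gas_dynamics n \<gamma> S) z = 1"
    and "pd u_ts_update (gas_dynamics n \<gamma> S) z = 0"
    and "pd u_ss_update (gas_dynamics n \<gamma> S) z = - gas_coeff n \<gamma> z * \<gamma> * S (js z) / u_s z"
    and "pd js_update (gas_dynamics n \<gamma> S) z = gas_coeff n \<gamma> z *
      (S2 - real n * \<gamma> * deriv S (js z) * (u_s z / u z) - \<gamma> * deriv S (js z) * (u_ss z / u_s z))"
    and "pd u_update (gas_dynamics n \<gamma> S) z = gas_coeff n \<gamma> z *
      (real n * (1 - \<gamma>) / u z * gas_bracket n \<gamma> S z + real n * \<gamma> * S (js z) * u_s z / (u z)\<^sup>2)"
    and "pd u_s_update (gas_dynamics n \<gamma> S) z = gas_coeff n \<gamma> z *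
      (- \<gamma> / u_s z * gas_bracket n \<gamma> S z - real n * \<gamma> * S (js z) / u z
        + \<gamma> * S (js z) * u_ss z / (u_s z)\<^sup>2)"
proof -
  have sh: "((\<lambda>h. f (c + h)) has_real_derivative l) (at 0)"
    if "(f has_real_derivative l) (at c)" for f :: "real \<Rightarrow> real" and c l
    using DERIV_shift[of f l 0 c] that by (simp add: add.commute)
  show "pd jt_update (gas_dynamics n \<gamma> S) z = 0"
    "pd u_t_update (gas_dynamics n \<gamma> S) z = 0"
    "pd u_ts_update (gas_dynamics n \<gamma> S) z = 0"
    by (simp_all add: pd_def gas_dynamics_def)
  show "pd u_tt_update (gas_dynamics n \<gamma> S) z = 1"
    unfolding pd_def gas_dynamics_def
    by (rule DERIV_imp_deriv) (auto intro!: derivative_eq_intros)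
  show "pd u_ss_update (gas_dynamics n \<gamma> S) z = - gas_coeff n \<gamma> z * \<gamma> * S (js z) / u_s z"
    unfolding pd_def gas_dynamics_def gas_coeff_def
    by (rule DERIV_imp_deriv) (use assms(3) in \<open>auto intro!: derivative_eq_intros simp: field_simps\<close>)
  have Dj: "((\<lambda>h. u_tt z + (u z ^ n) powr (1 - \<gamma>) * u_s z powr (- \<gamma>) *
       (deriv S (js z + h) - real n * \<gamma> * S (js z + h) * (u_s z / u z)
        - \<gamma> * S (js z + h) * (u_ss z / u_s z))) has_real_derivative
     (u z ^ n) powr (1 - \<gamma>) * u_s z powr (- \<gamma>) *
      (S2 - real n * \<gamma> * deriv S (js z) * (u_s z / u z) - \<gamma> * deriv S (js z) * (u_ss z / u_s z))) (at 0)"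
    by (rule derivative_eq_intros sh[OF S(1)] sh[OF S(2)] refl)+ (simp add: algebra_simps)
  show "pd js_update (gas_dynamics n \<gamma> S) z = gas_coeff n \<gamma> z *
      (S2 - real n * \<gamma> * deriv S (js z) * (u_s z / u z) - \<gamma> * deriv S (js z) * (u_ss z / u_s z))"
    using DERIV_imp_deriv[OF Dj] by (simp add: pd_def gas_dynamics_def gas_coeff_def)
  \<comment> \<open>The factor \<open>real n\<close> stays inside: for n = 0 the value
    \<open>u z\<close> may be 0, where the quotient alone is not differentiable.\<close>
  have Du: "((\<lambda>h. real n * (u_s z / (u z + h))) has_real_derivative - real n * u_s z / (u z)\<^sup>2) (at 0)"
  proof (cases "n = 0")
    case False
    then show ?thesis using assms(4)
      by (auto intro!: derivative_eq_intros simp: power2_eq_square)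
  qed simp
  have "((\<lambda>h. u_tt z + ((u z + h) ^ n) powr (1 - \<gamma>) * (u_s z powr (- \<gamma>) *
       (deriv S (js z) - \<gamma> * S (js z) * (real n * (u_s z / (u z + h)))
        - \<gamma> * S (js z) * (u_ss z / u_s z)))) has_real_derivative
     real n * (1 - \<gamma>) / u z * (u z ^ n) powr (1 - \<gamma>) * (u_s z powr (- \<gamma>) *
       (deriv S (js z) - \<gamma> * S (js z) * (real n * (u_s z / u z))
        - \<gamma> * S (js z) * (u_ss z / u_s z))) + (u z ^ n) powr (1 - \<gamma>) * (u_s z powr (- \<gamma>) *
       (\<gamma> * S (js z) * (real n * u_s z / (u z)\<^sup>2)))) (at 0)"
    by (rule derivative_eq_intros DERIV_power_powr[OF assms(4)] Du refl)+ simp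
  moreover have "(\<lambda>h. gas_dynamics n \<gamma> S (u_update (\<lambda>x. x + h) z)) = (\<lambda>h. u_tt z + ((u z + h) ^ n) powr (1 - \<gamma>) * (u_s z powr (- \<gamma>) *
       (deriv S (js z) - \<gamma> * S (js z) * (real n * (u_s z / (u z + h)))
        - \<gamma> * S (js z) * (u_ss z / u_s z))))"
    by (simp add: gas_dynamics_def ac_simps)
  ultimately
  show "pd u_update (gas_dynamics n \<gamma> S) z = gas_coeff n \<gamma> z *
      (real n * (1 - \<gamma>) / u z * gas_bracket n \<gamma> S z + real n * \<gamma> * S (js z) * u_s z / (u z)\<^sup>2)"
    unfolding pd_def gas_coeff_def gas_bracket_def
    by (simp add: DERIV_imp_deriv) (simp add: divide_inverse power2_eq_square algebra_simps)
  have Dp: "((\<lambda>h. (u_s z + h) powr (- \<gamma>)) has_real_derivative - \<gamma> / u_s z * u_s z powr (- \<gamma>)) (at 0)"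
    using assms(3) by (auto intro!: derivative_eq_intros simp: powr_diff field_simps)
  have Dq: "((\<lambda>h. u_ss z / (u_s z + h)) has_real_derivative - u_ss z / (u_s z)\<^sup>2) (at 0)"
    using assms(3) by (auto intro!: derivative_eq_intros simp: power2_eq_square)
  have "((\<lambda>h. u_tt z + (u_s z + h) powr (- \<gamma>) * ((u z ^ n) powr (1 - \<gamma>) *
       (deriv S (js z) - real n * \<gamma> * S (js z) / u z * (u_s z + h)
        - \<gamma> * S (js z) * (u_ss z / (u_s z + h))))) has_real_derivative
     - \<gamma> / u_s z * u_s z powr (- \<gamma>) * ((u z ^ n) powr (1 - \<gamma>) *
       (deriv S (js z) - real n * \<gamma> * S (js z) / u z * u_s z
        - \<gamma> * S (js z) * (u_ss z / u_s z))) + u_s z powr (- \<gamma>) * ((u z ^ n) powr (1 - \<gamma>) *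
       (- real n * \<gamma> * S (js z) / u z + \<gamma> * S (js z) * u_ss z / (u_s z)\<^sup>2))) (at 0)"
    by (rule derivative_eq_intros Dp Dq refl)+ simp
  moreover have "(\<lambda>h. gas_dynamics n \<gamma> S (u_s_update (\<lambda>x. x + h) z)) = (\<lambda>h. u_tt z + (u_s z + h) powr (- \<gamma>) * ((u z ^ n) powr (1 - \<gamma>) *
       (deriv S (js z) - real n * \<gamma> * S (js z) / u z * (u_s z + h)
        - \<gamma> * S (js z) * (u_ss z / (u_s z + h)))))"
    by (simp add: gas_dynamics_def ac_simps)
  ultimately
  show "pd u_s_update (gas_dynamics n \<gamma> S) z = gas_coeff n \<gamma> z *
      (- \<gamma> / u_s z * gas_bracket n \<gamma> S z - real n * \<gamma> * S (js z) / u z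
        + \<gamma> * S (js z) * u_ss z / (u_s z)\<^sup>2)"
    unfolding pd_def gas_coeff_def gas_bracket_def
    by (simp add: DERIV_imp_deriv) (simp add: divide_inverse power2_eq_square algebra_simps)
qed

section \<open>Splitting the symmetry condition\<close>

text \<open>The polynomial (X - b)(X - c) vanishes at b and c but not at a. Its coefficients are the
  multipliers with which the three equations are combined to eliminate \<open>c1\<close> and
  \<open>c2\<close>.\<close>

lemma vandermonde3:
  fixes c0 c1 c2 a b c :: real
  assumes "a \<noteq> b" "a \<noteq> c" "c0 + c1 + c2 = 0" "c0 * a + c1 * b + c2 * c = 0"
    "c0 * a\<^sup>2 + c1 * b\<^sup>2 + c2 * c\<^sup>2 = 0"
  shows "c0 = 0"
proof -
  have "c0 * ((a - b) * (a - c)) = b * c * (c0 + c1 + c2) - (b + c) * (c0 * a + c1 * b + c2 * c)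
    + (c0 * a\<^sup>2 + c1 * b\<^sup>2 + c2 * c\<^sup>2)"
    by (simp add: algebra_simps power2_eq_square)
  then show ?thesis using assms by simp
qed

lemma powr_independent:
  fixes c0 c1 c2 d e f :: real
  assumes "d \<noteq> e" "d \<noteq> f" "e \<noteq> f"
    and 0: "\<And>p. p > 0 \<Longrightarrow> c0 * p powr d + c1 * p powr e + c2 * p powr f = 0"
  shows "c0 = 0" "c1 = 0" "c2 = 0"
proof -
  have ne: "(2::real) powr x \<noteq> 2 powr y" if "x \<noteq> y" for x y :: real
    using that powr_inj[of 2 x y] by simp
  have sq: "(4::real) powr x = (2 powr x)\<^sup>2" for x :: real
    using powr_mult[of 2 2 x] by (simp add: power2_eq_square)
  \<comment> \<open>the values at 1, 2, 4 form a Vandermonde system in \<open>2 powr d\<close>, \<open>2 powr e\<close>, \<open>2 powr f\<close>\<close>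
  have e1: "c0 + c1 + c2 = 0" using 0[of 1] by simp
  have e2: "c0 * 2 powr d + c1 * 2 powr e + c2 * 2 powr f = 0" using 0[of 2] by simp
  have e3: "c0 * (2 powr d)\<^sup>2 + c1 * (2 powr e)\<^sup>2 + c2 * (2 powr f)\<^sup>2 = 0"
    using 0[of 4] by (simp add: sq)
  show "c0 = 0" by (rule vandermonde3[OF _ _ e1 e2 e3]) (use ne assms in auto)
  show "c1 = 0"
    by (rule vandermonde3[of "2 powr e" "2 powr d" "2 powr f" c1 c0 c2])
      (use ne assms e1 e2 e3 in \<open>auto simp: algebra_simps\<close>)
  show "c2 = 0"
    by (rule vandermonde3[of "2 powr f" "2 powr d" "2 powr e" c2 c0 c1])
      (use ne assms e1 e2 e3 in \<open>auto simp: algebra_simps\<close>)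
qed

locale gas_prolongation = prolongation "T \<times> I \<times> U" X \<tau>' \<sigma>' \<eta>' \<tau>'' \<sigma>'' \<eta>''
  for T I U :: "real set" and X \<tau>' \<sigma>' \<eta>' \<tau>'' \<sigma>'' \<eta>'' +
  fixes n :: nat and \<gamma> :: real and S :: "real \<Rightarrow> real"
  assumes gamma: "\<gamma> > 1"
    and S_DERIV: "\<And>s. s \<in> I \<Longrightarrow> (S has_real_derivative deriv S s) (at s)"
    and S_DERIV2: "\<And>s. s \<in> I \<Longrightarrow> (deriv S has_real_derivative deriv (deriv S) s) (at s)"
    and S_pos: "\<And>s. s \<in> I \<Longrightarrow> S s > 0"
    and U_pos: "n = 0 \<or> U \<subseteq> {0<..}"
begin

lemma prolong2_gas:
  assumes z: "base z \<in> T \<times> I \<times> U" and p: "u_s z > 0"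
  shows "prolong2 X (gas_dynamics n \<gamma> S) z = eta_tt X z + gas_coeff n \<gamma> z * (
      xi_s X z * (deriv (deriv S) (js z) - real n * \<gamma> * deriv S (js z) * (u_s z / u z)
        - \<gamma> * deriv S (js z) * (u_ss z / u_s z))
    + eta X z * (real n * (1 - \<gamma>) / u z * gas_bracket n \<gamma> S z + real n * \<gamma> * S (js z) * u_s z / (u z)\<^sup>2)
    + eta_s X z * (- \<gamma> / u_s z * gas_bracket n \<gamma> S z - real n * \<gamma> * S (js z) / u z
        + \<gamma> * S (js z) * u_ss z / (u_s z)\<^sup>2)
    - eta_ss X z * (\<gamma> * S (js z) / u_s z))"
proof -
  have s: "js z \<in> I" and u: "n = 0 \<or> u z > 0"
    using z U_pos by (auto simp: base_def)
  show ?thesis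
    unfolding prolong2_def gas_pd[OF S_DERIV[OF s] S_DERIV2[OF s] p u]
    by (simp add: algebra_simps)
qed

text \<open>The condition involves the field only and not the chosen derivative data, so it carries
  over unchanged from one choice of data to the next.\<close>

definition "symmetric \<longleftrightarrow> (\<forall>z. base z \<in> T \<times> I \<times> U \<and> u_s z > 0 \<and> gas_dynamics n \<gamma> S z = 0
  \<longrightarrow> prolong2 X (gas_dynamics n \<gamma> S) z = 0)"

text \<open>On the manifold \<open>u_ts\<close> is a free coordinate, and it enters the prolonged
  equation linearly: through \<eta>_tt with the total t-derivative of \<open>\<xi>\<^sup>s\<close>,
  and through \<eta>_ss with the total s-derivative of \<open>\<xi>\<^sup>t\<close>. The difference
  between the jets with \<open>u_ts\<close> equal to 1 and 0 isolates this coefficient, which is the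
  relation \<open>E\<close> below.\<close>

lemma symmetric_u_ts_coeff:
  assumes symmetric and p: "(t, s, x) \<in> T \<times> I \<times> U"
  shows "\<tau>' vs (t, s, x) = 0" "\<tau>' vu (t, s, x) = 0"
    "\<sigma>' vt (t, s, x) = 0" "\<sigma>' vu (t, s, x) = 0"
proof -
  have s: "s \<in> I" and u: "n = 0 \<or> x > 0"
    using p U_pos by (auto simp: base_def)
  define A where "A = (x ^ n) powr (1 - \<gamma>)"
  have A: "A > 0" using u by (auto simp: A_def)
  have E: "\<sigma>' vt (t, s, x) + v * \<sigma>' vu (t, s, x) =
      A * w powr (-\<gamma>) * \<gamma> * S s / w * (\<tau>' vs (t, s, x) + w * \<tau>' vu (t, s, x))"
    if w: "w > 0" for v w
  proof -
    \<comment> \<open>The value of \<open>u_tt\<close> solves the equation for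
      \<open>u_ss = 0\<close> and does not involve \<open>u_ts\<close>, so \<open>r\<close> is
      free.\<close>
    define z where "z r = \<lparr>jt = t, js = s, u = x, u_t = v, u_s = w,
      u_tt = - (A * w powr (- \<gamma>) * (deriv S s - real n * \<gamma> * S s * (w / x))), u_ts = r, u_ss = 0\<rparr>" for r
    have "gas_dynamics n \<gamma> S (z r) = 0" for r
      by (simp add: gas_dynamics_def z_def A_def)
    moreover have b: "base (z r) = (t, s, x)" "base (z r) \<in> T \<times> I \<times> U" "u_s (z r) > 0" for r
      using w p by (auto simp: base_def z_def)
    ultimately have "prolong2 X (gas_dynamics n \<gamma> S) (z r) = 0" for r
      using assms(1) by (auto simp: symmetric_def)
    then have "prolong2 X (gas_dynamics n \<gamma> S) (z 1) - prolong2 X (gas_dynamics n \<gamma> S) (z 0) = 0"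
      by simp
    then show ?thesis
      unfolding prolong2_gas[OF b(2,3)] eta_tt_eq[OF b(2)] eta_ss_eq[OF b(2)] eta_s_eq[OF b(2)]
        xi_s_def eta_def b(1) dt_def ds_def dtt_def dss_def gas_coeff_def gas_bracket_def
      by (simp add: z_def A_def algebra_simps) (use w in \<open>simp add: field_simps\<close>)
  qed
  \<comment> \<open>The right side of \<open>E\<close> does not contain \<open>v\<close>, so the
    left side may not either.\<close>
  from E[of 1 1] E[of 1 0] show su: "\<sigma>' vu (t, s, x) = 0" by simp
  \<comment> \<open>With \<open>v = 0\<close>, relation \<open>E\<close> is a combination of three
    powers of \<open>w\<close>; the exponents are distinct because \<gamma> > 1.\<close>
  have "\<sigma>' vt (t, s, x) * w powr 0 + (- A * \<gamma> * S s * \<tau>' vs (t, s, x)) * w powr (- \<gamma> - 1)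
     + (- A * \<gamma> * S s * \<tau>' vu (t, s, x)) * w powr (- \<gamma>) = 0" if w: "w > 0" for w
    using E[OF w, of 0] w by (simp add: powr_diff divide_simps) (simp add: algebra_simps)
  from powr_independent[OF _ _ _ this] gamma S_pos[OF s] A
  show "\<tau>' vs (t, s, x) = 0" "\<tau>' vu (t, s, x) = 0" "\<sigma>' vt (t, s, x) = 0"
    by auto
qed

text \<open>
  The coefficients of \<open>1\<close>, \<open>u_ss / u_s\<close> (up to a factor \<open>\<gamma>\<close>) and \<open>u_s\<close> that remain after division
  by \<open>gas_coeff\<close> when \<open>\<eta>\<close> does not depend on \<open>s\<close>.
\<close>

definition coeff_1 where
  "coeff_1 = (\<lambda>(t, s, x). deriv S s * (2 * \<tau>' vt (t, s, x) - \<eta>' vu (t, s, x))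
    + fst (snd (X (t, s, x))) * deriv (deriv S) s
    + snd (snd (X (t, s, x))) * real n * (1 - \<gamma>) / x * deriv S s
    - \<gamma> * (\<eta>' vu (t, s, x) - \<sigma>' vs (t, s, x)) * deriv S s + \<gamma> * \<sigma>'' vs vs (t, s, x) * S s)"

definition coeff_u_ss where
  "coeff_u_ss = (\<lambda>(t, s, x). S s * (\<eta>' vu (t, s, x) - 2 * \<tau>' vt (t, s, x))
    - fst (snd (X (t, s, x))) * deriv S s
    - snd (snd (X (t, s, x))) * real n * (1 - \<gamma>) / x * S s
    + (\<gamma> + 1) * (\<eta>' vu (t, s, x) - \<sigma>' vs (t, s, x)) * S s
    - (\<eta>' vu (t, s, x) - 2 * \<sigma>' vs (t, s, x)) * S s)"

definition coeff_u_s where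
  "coeff_u_s = (\<lambda>(t, s, x). real n * \<gamma> / x * (S s * (\<eta>' vu (t, s, x) - 2 * \<tau>' vt (t, s, x))
    - fst (snd (X (t, s, x))) * deriv S s
    - snd (snd (X (t, s, x))) * real n * (1 - \<gamma>) / x * S s
    + snd (snd (X (t, s, x))) / x * S s
    + (\<gamma> - 1) * (\<eta>' vu (t, s, x) - \<sigma>' vs (t, s, x)) * S s))"

text \<open>The pointwise form of \<open>\<xi>\<^sup>t\<close> depending on t only and
  \<open>\<xi>\<^sup>s\<close> on s only. Mixed derivatives are covered in both orders.\<close>

definition "separated P \<longleftrightarrow> (\<forall>v. v \<noteq> vt \<longrightarrow> \<tau>' v P = 0) \<and> (\<forall>v w. v \<noteq> vt \<or> w \<noteq> vt \<longrightarrow> \<tau>'' v w P = 0)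
  \<and> (\<forall>v. v \<noteq> vs \<longrightarrow> \<sigma>' v P = 0) \<and> (\<forall>v w. v \<noteq> vs \<or> w \<noteq> vs \<longrightarrow> \<sigma>'' v w P = 0)"

text \<open>The equation eliminates \<open>u_tt\<close>, and \<open>u_ts\<close> drops out because
  its coefficients vanish for separated data. The contributions of \<open>\<eta>' vs\<close> and of
  the second derivatives of \<eta> are left ungrouped: later steps make them vanish.\<close>

lemma prolong2_reduced:
  assumes z: "base z = P" "P \<in> T \<times> I \<times> U" and p: "u_s z > 0"
    and g: "gas_dynamics n \<gamma> S z = 0"
    and red: "separated P"
  shows "prolong2 X (gas_dynamics n \<gamma> S) z = \<eta>'' vt vt P
    + u_t z * (\<eta>'' vt vu P + \<eta>'' vu vt P - \<tau>'' vt vt P) + (u_t z)\<^sup>2 * \<eta>'' vu vu P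
    + gas_coeff n \<gamma> z * (coeff_1 P + coeff_u_s P * u_s z + \<gamma> * coeff_u_ss P * (u_ss z / u_s z)
      + \<eta>' vs P * (- \<gamma> / u_s z * gas_bracket n \<gamma> S z - real n * \<gamma> * S (js z) / u z
         + \<gamma> * S (js z) * u_ss z / (u_s z)\<^sup>2)
      - \<gamma> * S (js z) / u_s z * (\<eta>'' vs vs P + u_s z * (\<eta>'' vs vu P + \<eta>'' vu vs P)
         + (u_s z)\<^sup>2 * \<eta>'' vu vu P))"
proof -
  have b: "base z \<in> T \<times> I \<times> U" using z by simp
  note red = red[unfolded separated_def, THEN conjunct1, rule_format]
    red[unfolded separated_def, THEN conjunct2, THEN conjunct1, rule_format]
    red[unfolded separated_def, THEN conjunct2, THEN conjunct2, THEN conjunct1, rule_format]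
    red[unfolded separated_def, THEN conjunct2, THEN conjunct2, THEN conjunct2, rule_format]
  have P: "P = (jt z, js z, u z)" using z by (simp add: base_def)
  have utt: "u_tt z = - gas_coeff n \<gamma> z * gas_bracket n \<gamma> S z"
    using g by (simp add: gas_dynamics_alt)
  \<comment> \<open>In terms of \<open>w\<close> and \<open>y\<close> most of the identity is
    polynomial. The quotient n/u, where u may be 0 if n = 0, is treated as an opaque
    quantity.\<close>
  define w y where "w = u_ss z / u_s z" and "y = real n / u z"
  have w: "u_ss z = w * u_s z" using p by (simp add: w_def)
  have B: "gas_bracket n \<gamma> S z = deriv S (js z) - \<gamma> * S (js z) * y * u_s z - \<gamma> * S (js z) * w"
    by (simp add: gas_bracket_def w_def y_def)
  have 1: "eta_tt X z = \<eta>'' vt vt P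
    + u_t z * (\<eta>'' vt vu P + \<eta>'' vu vt P - \<tau>'' vt vt P) + (u_t z)\<^sup>2 * \<eta>'' vu vu P
    + u_tt z * (\<eta>' vu P - 2 * \<tau>' vt P)"
    unfolding eta_tt_eq[OF b] dt_def dtt_def z(1) by (simp add: red algebra_simps)
  have 2: "eta_ss X z = \<eta>'' vs vs P + u_s z * (\<eta>'' vs vu P + \<eta>'' vu vs P) + (u_s z)\<^sup>2 * \<eta>'' vu vu P
    + u_ss z * \<eta>' vu P - u_s z * \<sigma>'' vs vs P - 2 * u_ss z * \<sigma>' vs P"
    unfolding eta_ss_eq[OF b] ds_def dss_def z(1) by (simp add: red algebra_simps)
  have 3: "eta_s X z = \<eta>' vs P + u_s z * (\<eta>' vu P - \<sigma>' vs P)"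
    unfolding eta_s_eq[OF b] ds_def z(1) by (simp add: red algebra_simps)
  define c where "c = \<eta>' vu P - \<sigma>' vs P"
  define d where "d = \<eta>' vs P * (- \<gamma> / u_s z * gas_bracket n \<gamma> S z - \<gamma> * S (js z) * y
    + \<gamma> * S (js z) * u_ss z / (u_s z)\<^sup>2)"
  define e where "e = \<eta>'' vs vs P + u_s z * (\<eta>'' vs vu P + \<eta>'' vu vs P) + (u_s z)\<^sup>2 * \<eta>'' vu vu P"
  have 4: "eta_s X z * (- \<gamma> / u_s z * gas_bracket n \<gamma> S z - \<gamma> * S (js z) * y
        + \<gamma> * S (js z) * u_ss z / (u_s z)\<^sup>2)
    = d - \<gamma> * c * gas_bracket n \<gamma> S z - c * \<gamma> * S (js z) * y * u_s z + \<gamma> * S (js z) * w * c"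
    unfolding 3 d_def c_def[symmetric] w using p by (simp add: field_simps power2_eq_square)
  have 5: "eta_ss X z * (\<gamma> * S (js z) / u_s z) = \<gamma> * S (js z) / u_s z * e
    + \<gamma> * S (js z) * (w * \<eta>' vu P - \<sigma>'' vs vs P - 2 * w * \<sigma>' vs P)"
    unfolding 2 e_def[symmetric] w using p by (simp add: field_simps)
  have y: "real n * a / u z = a * y" "real n * a * b / u z = a * b * y"
    "real n * a * b * g / (u z)\<^sup>2 = a * b * g * y / u z" for a b g
    by (simp_all add: y_def power2_eq_square)
  have P: "P = (jt z, js z, u z)" using z by (simp add: base_def)
  have cs: "coeff_1 P = deriv S (js z) * (2 * \<tau>' vt P - \<eta>' vu P) + xi_s X z * deriv (deriv S) (js z)
      + eta X z * (1 - \<gamma>) * y * deriv S (js z) - \<gamma> * c * deriv S (js z) + \<gamma> * \<sigma>'' vs vs P * S (js z)"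
    "coeff_u_ss P = S (js z) * (\<eta>' vu P - 2 * \<tau>' vt P) - xi_s X z * deriv S (js z)
      - eta X z * (1 - \<gamma>) * y * S (js z) + (\<gamma> + 1) * c * S (js z) - (\<eta>' vu P - 2 * \<sigma>' vs P) * S (js z)"
    "coeff_u_s P = \<gamma> * y * (S (js z) * (\<eta>' vu P - 2 * \<tau>' vt P) - xi_s X z * deriv S (js z)
      - eta X z * (1 - \<gamma>) * y * S (js z) + eta X z / u z * S (js z) + (\<gamma> - 1) * c * S (js z))"
    by (simp_all add: coeff_1_def coeff_u_s_def coeff_u_ss_def xi_s_def eta_def z(1) c_def y_def P)
  have "prolong2 X (gas_dynamics n \<gamma> S) z = eta_tt X z + gas_coeff n \<gamma> z * (
      xi_s X z * (deriv (deriv S) (js z) - \<gamma> * deriv S (js z) * u_s z * y - \<gamma> * deriv S (js z) * w)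
    + eta X z * ((1 - \<gamma>) * y * gas_bracket n \<gamma> S z + \<gamma> * S (js z) * u_s z * y / u z)
    + eta_s X z * (- \<gamma> / u_s z * gas_bracket n \<gamma> S z - \<gamma> * S (js z) * y
        + \<gamma> * S (js z) * u_ss z / (u_s z)\<^sup>2)
    - eta_ss X z * (\<gamma> * S (js z) / u_s z))"
    unfolding prolong2_gas[OF b p] y_def w_def by (simp add: power2_eq_square ac_simps)
  also have "\<dots> = \<eta>'' vt vt P
    + u_t z * (\<eta>'' vt vu P + \<eta>'' vu vt P - \<tau>'' vt vt P) + (u_t z)\<^sup>2 * \<eta>'' vu vu P
    + gas_coeff n \<gamma> z * (coeff_1 P + coeff_u_s P * u_s z + \<gamma> * coeff_u_ss P * w
      + d - \<gamma> * S (js z) / u_s z * e)"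
    unfolding 4 5 unfolding 1 utt cs B by (simp add: algebra_simps)
  finally show ?thesis unfolding d_def e_def y_def w_def by simp
qed


text \<open>The equation can be solved for \<open>u_tt\<close>. Over each base point the values
  \<open>u_t = v\<close>, \<open>u_s = w > 0\<close> and \<open>u_ss = q\<close> are therefore free,
  and this freedom is what permits splitting.\<close>

lemma symmetric_separated:
  assumes symmetric and p: "(t, s, x) \<in> T \<times> I \<times> U" and "separated (t, s, x)" and w: "w > 0"
  defines "P \<equiv> (t, s, x)"
  shows "\<eta>'' vt vt P + v * (\<eta>'' vt vu P + \<eta>'' vu vt P - \<tau>'' vt vt P) + v\<^sup>2 * \<eta>'' vu vu P
    + (x ^ n) powr (1 - \<gamma>) * w powr (- \<gamma>) * (coeff_1 P + coeff_u_s P * w + \<gamma> * coeff_u_ss P * (q / w)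
      + \<eta>' vs P * (- \<gamma> / w * (deriv S s - real n * \<gamma> * S s * (w / x) - \<gamma> * S s * (q / w))
         - real n * \<gamma> * S s / x + \<gamma> * S s * q / w\<^sup>2)
      - \<gamma> * S s / w * (\<eta>'' vs vs P + w * (\<eta>'' vs vu P + \<eta>'' vu vs P) + w\<^sup>2 * \<eta>'' vu vu P)) = 0"
proof -
  define z where "z = \<lparr>jt = t, js = s, u = x, u_t = v, u_s = w,
      u_tt = - ((x ^ n) powr (1 - \<gamma>) * w powr (- \<gamma>) *
        (deriv S s - real n * \<gamma> * S s * (w / x) - \<gamma> * S s * (q / w))), u_ts = 0, u_ss = q\<rparr>"
  have g: "gas_dynamics n \<gamma> S z = 0"
    by (simp add: gas_dynamics_def z_def)
  have b: "base z = P" "P \<in> T \<times> I \<times> U" "u_s z > 0" "separated P"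
    using w assms(2,3) by (auto simp: base_def z_def P_def)
  have "prolong2 X (gas_dynamics n \<gamma> S) z = 0"
    using \<open>symmetric\<close> b g by (auto simp: symmetric_def)
  then show ?thesis
    unfolding prolong2_reduced[OF b(1-3) g b(4)]
    by (simp add: z_def gas_coeff_def gas_bracket_def)
qed

text \<open>For fixed \<open>w\<close> and \<open>q\<close> the identity is quadratic in
  \<open>v\<close>, which yields the first two claims. For \<open>v = 0\<close> it is affine in
  \<open>q\<close>, with a slope that is a positive multiple of
  \<open>w * coeff_u_ss P + (\<gamma> + 1) * S s * \<eta>' vs P\<close>. This vanishes for all
  \<open>w > 0\<close>, so both of its coefficients vanish.\<close>

lemma symmetric_coeffs:
  assumes symmetric and P: "P \<in> T \<times> I \<times> U" and red: "separated P"
  shows "\<eta>'' vu vu P = 0" "\<eta>'' vt vu P + \<eta>'' vu vt P = \<tau>'' vt vt P" "\<eta>' vs P = 0" "coeff_u_ss P = 0"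
proof -
  obtain t s x where Pe: "P = (t, s, x)" by (cases P)
  have p: "(t, s, x) \<in> T \<times> I \<times> U" and red: "separated (t, s, x)" using P red Pe by auto
  have s: "s \<in> I" and x: "n = 0 \<or> x > 0"
    using p U_pos by auto
  have A: "(x ^ n) powr (1 - \<gamma>) > 0" using x by auto
  note E = symmetric_separated[OF \<open>symmetric\<close> p red, folded Pe]
  \<comment> \<open>With \<open>w = 1\<close> and \<open>q = 0\<close> fixed, everything outside the
    displayed polynomial in \<open>v\<close> is a single constant.\<close>
  obtain k where k: "\<eta>'' vt vt P + v * (\<eta>'' vt vu P + \<eta>'' vu vt P - \<tau>'' vt vt P)
      + v\<^sup>2 * \<eta>'' vu vu P + k = 0" for v
    by (rule that, rule E[of 1 _ 0, OF zero_less_one])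
  show N: "\<eta>'' vu vu P = 0" using k[of 1] k[of "-1"] k[of 0] by simp
  show M: "\<eta>'' vt vu P + \<eta>'' vu vt P = \<tau>'' vt vt P"
    using k[of 1] k[of "-1"] k[of 0] by simp
  have q: "w * coeff_u_ss P + (\<gamma> + 1) * S s * \<eta>' vs P = 0" if w: "w > 0" for w
  proof -
    define R where "R q = coeff_1 P + coeff_u_s P * w + \<gamma> * coeff_u_ss P * (q / w)
      + \<eta>' vs P * (- \<gamma> / w * (deriv S s - real n * \<gamma> * S s * (w / x) - \<gamma> * S s * (q / w))
         - real n * \<gamma> * S s / x + \<gamma> * S s * q / w\<^sup>2)
      - \<gamma> * S s / w * (\<eta>'' vs vs P + w * (\<eta>'' vs vu P + \<eta>'' vu vs P) + w\<^sup>2 * \<eta>'' vu vu P)" for q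
    have R: "\<eta>'' vt vt P + (x ^ n) powr (1 - \<gamma>) * w powr (- \<gamma>) * R q = 0" for q
      using E[OF w, of 0 q] unfolding R_def by (simp only: mult_zero_left zero_power2 add_0_right)
    have "(x ^ n) powr (1 - \<gamma>) * w powr (- \<gamma>) * R 1 = (x ^ n) powr (1 - \<gamma>) * w powr (- \<gamma>) * R 0"
      using R[of 1] R[of 0] by linarith
    then have "R 1 - R 0 = 0" using A w x by auto
    moreover have "R 1 - R 0 = \<gamma> / w\<^sup>2 * (w * coeff_u_ss P + (\<gamma> + 1) * S s * \<eta>' vs P)"
      unfolding R_def using w by (simp add: field_simps power2_eq_square)
    ultimately show ?thesis using w gamma by simp
  qed
  show C: "coeff_u_ss P = 0" using q[of 1] q[of 2] by simp
  show "\<eta>' vs P = 0" using q[of 1] C gamma S_pos[OF s] by simp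
qed

text \<open>At \<open>v = q = 0\<close> the powers of \<open>w\<close> with exponents 0, -\<gamma>
  and 1-\<gamma> remain, distinct because \<gamma> > 1. Without the assumptions on \<eta>, the mixed
  derivatives would merge with \<open>coeff_1\<close>, and \<open>\<eta>'' vs vs\<close> would bring
  in the exponent -\<gamma>-1.\<close>

lemma symmetric_coeffs_s_independent:
  assumes symmetric and P: "P \<in> T \<times> I \<times> U" and red: "separated P"
    and eta: "\<eta>'' vs vs P = 0" "\<eta>'' vs vu P = 0" "\<eta>'' vu vs P = 0"
  shows "\<eta>'' vt vt P = 0" "coeff_1 P = 0"
proof -
  obtain t s x where Pe: "P = (t, s, x)" by (cases P)
  have p: "(t, s, x) \<in> T \<times> I \<times> U" and red': "separated (t, s, x)" using P red Pe by auto
  have x: "n = 0 \<or> x > 0"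
    using p U_pos by auto
  have A: "(x ^ n) powr (1 - \<gamma>) > 0" using x by auto
  note E = symmetric_separated[OF \<open>symmetric\<close> p red', folded Pe]
  note c = symmetric_coeffs[OF \<open>symmetric\<close> P red]
  have "\<eta>'' vt vt P * w powr 0 + ((x ^ n) powr (1 - \<gamma>) * coeff_1 P) * w powr (- \<gamma>)
     + ((x ^ n) powr (1 - \<gamma>) * coeff_u_s P) * w powr (1 - \<gamma>) = 0" if w: "w > 0" for w
    using E[OF w, of 0 0] w by (simp add: c eta powr_add[of w 1 "- \<gamma>", simplified] algebra_simps)
  from powr_independent[OF _ _ _ this] gamma A
  show "\<eta>'' vt vt P = 0" "coeff_1 P = 0" by auto
qed

lemma symmetricI:
  assumes "\<And>P. P \<in> T \<times> I \<times> U \<Longrightarrow> separated P \<and> coeff_1 P = 0 \<and> coeff_u_ss P = 0 \<and> coeff_u_s P = 0 \<and>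
    \<eta>' vs P = 0 \<and> \<eta>'' vs vs P = 0 \<and> \<eta>'' vs vu P = 0 \<and> \<eta>'' vu vs P = 0 \<and> \<eta>'' vt vt P = 0 \<and>
    \<eta>'' vu vu P = 0 \<and> \<eta>'' vt vu P + \<eta>'' vu vt P = \<tau>'' vt vt P"
  shows symmetric
  unfolding symmetric_def
proof (intro allI impI, elim conjE)
  fix z assume z: "base z \<in> T \<times> I \<times> U" "u_s z > 0" "gas_dynamics n \<gamma> S z = 0"
  show "prolong2 X (gas_dynamics n \<gamma> S) z = 0"
    using prolong2_reduced[OF refl z] assms[OF z(1)] by simp
qed

end

section \<open>Smooth functions on boxes\<close>

fun unit_vec :: "var \<Rightarrow> real \<times> real \<times> real" where
  "unit_vec vt = (1, 0, 0)" | "unit_vec vs = (0, 1, 0)" | "unit_vec vu = (0, 0, 1)"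

text \<open>\<open>L\<close> will be one of the coordinate projections, so a single argument serves
  all three components of a vector field.\<close>

lemma differentiable_imp_partials:
  assumes "\<forall>p\<in>D. g differentiable (at p)" "bounded_linear L"
  shows "partials D (\<lambda>p. L (g p)) (\<lambda>v p. L (frechet_derivative g (at p) (unit_vec v)))"
  unfolding partials_def
proof
  fix p assume "p \<in> D"
  then have d: "(g has_derivative frechet_derivative g (at p)) (at p)"
    using assms(1) frechet_derivative_works by blast
  then interpret G: bounded_linear "frechet_derivative g (at p)" by (rule has_derivative_bounded_linear)
  interpret L: bounded_linear L by fact
  have "L (frechet_derivative g (at p) h) = fst h * L (frechet_derivative g (at p) (unit_vec vt))
     + fst (snd h) * L (frechet_derivative g (at p) (unit_vec vs))
     + snd (snd h) * L (frechet_derivative g (at p) (unit_vec vu))" for h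
  proof -
    have "h = fst h *\<^sub>R unit_vec vt + fst (snd h) *\<^sub>R unit_vec vs + snd (snd h) *\<^sub>R unit_vec vu"
      by (cases h) auto
    then have "L (frechet_derivative g (at p) h) = L (frechet_derivative g (at p)
      (fst h *\<^sub>R unit_vec vt + fst (snd h) *\<^sub>R unit_vec vs + snd (snd h) *\<^sub>R unit_vec vu))" by simp
    also have "\<dots> = fst h * L (frechet_derivative g (at p) (unit_vec vt))
     + fst (snd h) * L (frechet_derivative g (at p) (unit_vec vs))
     + snd (snd h) * L (frechet_derivative g (at p) (unit_vec vu))"
      by (simp only: G.add G.scale L.add L.scale real_scaleR_def)
    finally show ?thesis .
  qed
  then have "(\<lambda>h. L (frechet_derivative g (at p) h)) = (\<lambda>h. fst h * L (frechet_derivative g (at p) (unit_vec vt))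
     + fst (snd h) * L (frechet_derivative g (at p) (unit_vec vs))
     + snd (snd h) * L (frechet_derivative g (at p) (unit_vec vu)))" by (rule ext)
  with L.has_derivative[OF d] show "((\<lambda>p. L (g p)) has_derivative
      (\<lambda>h. fst h * L (frechet_derivative g (at p) (unit_vec vt))
         + fst (snd h) * L (frechet_derivative g (at p) (unit_vec vs))
         + snd (snd h) * L (frechet_derivative g (at p) (unit_vec vu)))) (at p)"
    by (simp only:)
qed

lemma smooth_on_imp_partials2:
  assumes "smooth_on D X" "bounded_linear L"
  shows "\<exists>f' f''. partials2 D (\<lambda>p. L (X p)) f' f''"
proof -
  have "C_k_on (Suc (Suc 0)) D X" using assms(1) by (auto simp: smooth_on_def)
  then have d: "\<forall>p\<in>D. X differentiable (at p)"
    "\<forall>v. \<forall>p\<in>D. (\<lambda>p. frechet_derivative X (at p) v) differentiable (at p)"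
    unfolding C_k_on.simps by blast+
  show ?thesis
    unfolding partials2_def
    by (intro exI conjI allI, rule differentiable_imp_partials[OF d(1) assms(2)],
      rule differentiable_imp_partials[OF d(2)[THEN spec] assms(2)])
qed

text \<open>Smoothness speaks of \<open>frechet_derivative S (at x) 1\<close>, which is shown to
  equal \<open>deriv S x\<close> on \<open>I\<close>. As \<open>I\<close> is open, differentiability
  passes from one to the other.\<close>

lemma smooth_on_imp_DERIV:
  fixes S :: "real \<Rightarrow> real"
  assumes "smooth_on I S" "open I" "s \<in> I"
  shows "(S has_real_derivative deriv S s) (at s)"
    and "(deriv S has_real_derivative deriv (deriv S) s) (at s)"
proof -
  have C: "C_k_on (Suc (Suc 0)) I S" using assms(1) by (auto simp: smooth_on_def)
  have 1: "(S has_real_derivative deriv S x) (at x)" if "x \<in> I" for x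
    using C that by (simp add: DERIV_deriv_iff_real_differentiable)
  then show "(S has_real_derivative deriv S s) (at s)" using assms(3) .
  have "frechet_derivative S (at x) 1 = deriv S x" if "x \<in> I" for x
    using frechet_derivative_at[OF 1[OF that, unfolded has_field_derivative_def]] by (metis mult.right_neutral)
  moreover have "(\<lambda>x. frechet_derivative S (at x) 1) differentiable (at s)"
    using C assms(3) by simp
  ultimately have "deriv S differentiable (at s)"
    unfolding differentiable_def
    using has_derivative_transform_within_open[OF _ assms(2,3), of _ _ UNIV "deriv S"] by blast
  then show "(deriv S has_real_derivative deriv (deriv S) s) (at s)"
    by (simp add: DERIV_deriv_iff_real_differentiable)
qed

lemma partials_cong:
  assumes "partials D f f'" "open D" "\<And>p. p \<in> D \<Longrightarrow> f p = g p"
  shows "partials D g f'"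
  unfolding partials_def
proof
  fix p assume "p \<in> D"
  then show "(g has_derivative
      (\<lambda>h. fst h * f' vt p + fst (snd h) * f' vs p + snd (snd h) * f' vu p)) (at p)"
    using has_derivative_transform_within_open[OF _ assms(2), of f _ p UNIV g] assms(1,3)
    by (simp add: partials_def)
qed

lemma partials2_cong:
  "partials2 D f f' f'' \<Longrightarrow> open D \<Longrightarrow> (\<And>p. p \<in> D \<Longrightarrow> f p = g p) \<Longrightarrow> partials2 D g f' f''"
  unfolding partials2_def using partials_cong by blast

lemma partials_zero: "partials D (\<lambda>p. 0) (\<lambda>v p. 0)"
  by (simp add: partials_def)

section \<open>Freezing some of the variables\<close>

lemma partials_compose:
  assumes "partials D f f'" "\<And>p. p \<in> E \<Longrightarrow> \<pi> p \<in> D" "\<And>p. p \<in> E \<Longrightarrow> (\<pi> has_derivative \<pi>' p) (at p)"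
    "\<And>p h. p \<in> E \<Longrightarrow> fst (\<pi>' p h) * f' vt (\<pi> p) + fst (snd (\<pi>' p h)) * f' vs (\<pi> p)
      + snd (snd (\<pi>' p h)) * f' vu (\<pi> p) = fst h * g' vt p + fst (snd h) * g' vs p + snd (snd h) * g' vu p"
  shows "partials E (\<lambda>p. f (\<pi> p)) g'"
  unfolding partials_def
proof
  fix p assume p: "p \<in> E"
  have "((\<lambda>p. f (\<pi> p)) has_derivative (\<lambda>h. fst (\<pi>' p h) * f' vt (\<pi> p) + fst (snd (\<pi>' p h)) * f' vs (\<pi> p)
      + snd (snd (\<pi>' p h)) * f' vu (\<pi> p))) (at p)"
    using has_derivative_compose[OF assms(3)[OF p], of f]
      assms(1)[unfolded partials_def, rule_format, OF assms(2)[OF p]] by blast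
  then show "((\<lambda>p. f (\<pi> p)) has_derivative
      (\<lambda>h. fst h * g' vt p + fst (snd h) * g' vs p + snd (snd h) * g' vu p)) (at p)"
    using assms(4)[OF p] by simp
qed

lemma partials_t_slice:
  assumes "partials (T \<times> I \<times> U) f f'" "s0 \<in> I" "x0 \<in> U"
  shows "partials (T \<times> I \<times> U) (\<lambda>p. f (fst p, s0, x0)) (\<lambda>v p. if v = vt then f' vt (fst p, s0, x0) else 0)"
  by (rule partials_compose[OF assms(1), of _ _ "\<lambda>p h. (fst h, 0, 0)"])
    (use assms in \<open>auto intro!: derivative_eq_intros simp: zero_prod_def\<close>)

lemma partials_s_slice:
  assumes "partials (T \<times> I \<times> U) f f'" "t0 \<in> T" "x0 \<in> U"
  shows "partials (T \<times> I \<times> U) (\<lambda>p. f (t0, fst (snd p), x0)) (\<lambda>v p. if v = vs then f' vs (t0, fst (snd p), x0) else 0)"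
  by (rule partials_compose[OF assms(1), of _ _ "\<lambda>p h. (0, fst (snd h), 0)"])
    (use assms in \<open>auto intro!: derivative_eq_intros simp: zero_prod_def\<close>)

lemma partials_tu_slice:
  assumes "partials (T \<times> I \<times> U) f f'" "s0 \<in> I"
  shows "partials (T \<times> I \<times> U) (\<lambda>p. f (fst p, s0, snd (snd p))) (\<lambda>v p. if v = vs then 0 else f' v (fst p, s0, snd (snd p)))"
  by (rule partials_compose[OF assms(1), of _ _ "\<lambda>p h. (fst h, 0, snd (snd h))"])
    (use assms in \<open>auto intro!: derivative_eq_intros simp: zero_prod_def\<close>)

lemma partials2_t_slice:
  assumes "partials2 (T \<times> I \<times> U) f f' f''" "s0 \<in> I" "x0 \<in> U"
  shows "partials2 (T \<times> I \<times> U) (\<lambda>p. f (fst p, s0, x0)) (\<lambda>v p. if v = vt then f' vt (fst p, s0, x0) else 0)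
    (\<lambda>v w p. if v = vt \<and> w = vt then f'' vt vt (fst p, s0, x0) else 0)"
  unfolding partials2_def
proof (intro conjI allI)
  show "partials (T \<times> I \<times> U) (\<lambda>p. f (fst p, s0, x0)) (\<lambda>v p. if v = vt then f' vt (fst p, s0, x0) else 0)"
    using assms partials_t_slice by (auto simp: partials2_def)
  fix v show "partials (T \<times> I \<times> U) (\<lambda>p. if v = vt then f' vt (fst p, s0, x0) else 0)
     (\<lambda>w p. if v = vt \<and> w = vt then f'' vt vt (fst p, s0, x0) else 0)"
    using assms partials_t_slice[of T I U "f' vt" "f'' vt"] partials_zero
    by (cases "v = vt") (auto simp: partials2_def)
qed

lemma partials2_s_slice:
  assumes "partials2 (T \<times> I \<times> U) f f' f''" "t0 \<in> T" "x0 \<in> U"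
  shows "partials2 (T \<times> I \<times> U) (\<lambda>p. f (t0, fst (snd p), x0)) (\<lambda>v p. if v = vs then f' vs (t0, fst (snd p), x0) else 0)
    (\<lambda>v w p. if v = vs \<and> w = vs then f'' vs vs (t0, fst (snd p), x0) else 0)"
  unfolding partials2_def
proof (intro conjI allI)
  show "partials (T \<times> I \<times> U) (\<lambda>p. f (t0, fst (snd p), x0)) (\<lambda>v p. if v = vs then f' vs (t0, fst (snd p), x0) else 0)"
    using assms partials_s_slice by (auto simp: partials2_def)
  fix v show "partials (T \<times> I \<times> U) (\<lambda>p. if v = vs then f' vs (t0, fst (snd p), x0) else 0)
     (\<lambda>w p. if v = vs \<and> w = vs then f'' vs vs (t0, fst (snd p), x0) else 0)"
    using assms partials_s_slice[of T I U "f' vs" "f'' vs"] partials_zero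
    by (cases "v = vs") (auto simp: partials2_def)
qed

lemma partials2_tu_slice:
  assumes "partials2 (T \<times> I \<times> U) f f' f''" "s0 \<in> I"
  shows "partials2 (T \<times> I \<times> U) (\<lambda>p. f (fst p, s0, snd (snd p)))
    (\<lambda>v p. if v = vs then 0 else f' v (fst p, s0, snd (snd p)))
    (\<lambda>v w p. if v = vs \<or> w = vs then 0 else f'' v w (fst p, s0, snd (snd p)))"
  unfolding partials2_def
proof (intro conjI allI)
  show "partials (T \<times> I \<times> U) (\<lambda>p. f (fst p, s0, snd (snd p)))
      (\<lambda>v p. if v = vs then 0 else f' v (fst p, s0, snd (snd p)))"
    using assms partials_tu_slice by (auto simp: partials2_def)
  fix v show "partials (T \<times> I \<times> U) (\<lambda>p. if v = vs then 0 else f' v (fst p, s0, snd (snd p)))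
     (\<lambda>w p. if v = vs \<or> w = vs then 0 else f'' v w (fst p, s0, snd (snd p)))"
    using assms partials_tu_slice[of T I U "f' v" "f'' v"] partials_zero
    by (cases "v = vs") (auto simp: partials2_def)
qed

section \<open>Functions on boxes with vanishing derivatives\<close>

lemma slice_constant:
  assumes f: "partials (T \<times> I \<times> U) f f'" and "is_interval T" "is_interval I" "is_interval U"
    and t: "t \<in> T" "t0 \<in> T" and s: "s \<in> I" "s0 \<in> I" and x: "x \<in> U" "x0 \<in> U"
  shows "(\<And>p. p \<in> T \<times> I \<times> U \<Longrightarrow> f' vt p = 0) \<Longrightarrow> f (t, s, x) = f (t0, s, x)"
    "(\<And>p. p \<in> T \<times> I \<times> U \<Longrightarrow> f' vs p = 0) \<Longrightarrow> f (t, s, x) = f (t, s0, x)"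
    "(\<And>p. p \<in> T \<times> I \<times> U \<Longrightarrow> f' vu p = 0) \<Longrightarrow> f (t, s, x) = f (t, s, x0)"
proof -
  have c: "g a = g b" if "is_interval A" "a \<in> A" "b \<in> A" "\<And>r. r \<in> A \<Longrightarrow> (g has_real_derivative 0) (at r)"
    for g :: "real \<Rightarrow> real" and a b A
    using has_field_derivative_zero_constant[of A g] that by (metis DERIV_subset is_interval_convex subset_UNIV)
  note d = partials_DERIV[OF f]
  show "f (t, s, x) = f (t0, s, x)" if "\<And>p. p \<in> T \<times> I \<times> U \<Longrightarrow> f' vt p = 0"
    by (rule c[of T t t0 "\<lambda>r. f (r, s, x)"]) (use assms d(1)[of _ s x] that in auto)
  show "f (t, s, x) = f (t, s0, x)" if "\<And>p. p \<in> T \<times> I \<times> U \<Longrightarrow> f' vs p = 0"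
    by (rule c[of I s s0 "\<lambda>r. f (t, r, x)"]) (use assms d(2)[of t _ x] that in auto)
  show "f (t, s, x) = f (t, s, x0)" if "\<And>p. p \<in> T \<times> I \<times> U \<Longrightarrow> f' vu p = 0"
    by (rule c[of U x x0 "\<lambda>r. f (t, s, r)"]) (use assms d(3)[of t s] that in auto)
qed

lemma DERIV2_zero_imp_affine:
  fixes f :: "real \<Rightarrow> real"
  assumes "is_interval A" "\<And>r. r \<in> A \<Longrightarrow> (f has_real_derivative f' r) (at r)"
    "\<And>r. r \<in> A \<Longrightarrow> (f' has_real_derivative 0) (at r)"
  shows "\<exists>c d. \<forall>r\<in>A. f r = c + d * r \<and> f' r = d"
proof -
  have k: "\<exists>c. \<forall>r\<in>A. g r = c" if "\<And>r. r \<in> A \<Longrightarrow> (g has_real_derivative 0) (at r)" for g :: "real \<Rightarrow> real"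
    using has_field_derivative_zero_constant[of A g] that assms(1) by (metis DERIV_subset is_interval_convex subset_UNIV)
  obtain d where d: "\<forall>r\<in>A. f' r = d" using k[of f'] assms(3) by blast
  have "\<exists>c. \<forall>r\<in>A. f r - d * r = c"
    by (rule k) (use d assms(2) in \<open>auto intro!: derivative_eq_intros\<close>)
  then obtain c where "\<forall>r\<in>A. f r - d * r = c" by blast
  with d have "\<forall>r\<in>A. f r = c + d * r \<and> f' r = d" by (auto simp: algebra_simps)
  then show ?thesis by blast
qed

text \<open>Supplies the second point wherever a coefficient is found by comparing values at two
  points.\<close>

lemma open_obtain_other:
  fixes A :: "real set" assumes "open A" "a \<in> A"
  obtains b where "b \<in> A" "b \<noteq> a"
  using assms not_open_singleton[of a] by (metis insertI1 singletonD subsetI subset_antisym empty_subsetI insert_subset)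

text \<open>In each hypothesis the coefficients may depend on the fixed variable in an unknown way.
  The values on two lines x = a and x = b are affine in t and determine the affine function of x for
  every t, which settles this dependence.\<close>

lemma affine_in_each_imp_biaffine:
  fixes h :: "real \<Rightarrow> real \<Rightarrow> real"
  assumes "open U" "U \<noteq> {}"
    and t: "\<And>x. x \<in> U \<Longrightarrow> \<exists>c d. \<forall>t\<in>T. h t x = c + d * t"
    and x: "\<And>t. t \<in> T \<Longrightarrow> \<exists>c d. \<forall>x\<in>U. h t x = c + d * x"
  shows "\<exists>\<alpha> \<beta> \<delta> \<epsilon>. \<forall>t\<in>T. \<forall>x\<in>U. h t x = \<alpha> + \<beta> * t + (\<delta> + \<epsilon> * t) * x"
proof -
  obtain a where a: "a \<in> U" using assms by blast
  then obtain b where b: "b \<in> U" "b \<noteq> a" using open_obtain_other assms by blast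
  obtain ca da where A: "\<forall>t\<in>T. h t a = ca + da * t" using t[OF a] by blast
  obtain cb db where B: "\<forall>t\<in>T. h t b = cb + db * t" using t[OF b(1)] by blast
  \<comment> \<open>Intercept and slope, in t, of the difference quotient of \<open>h t\<close>
    between \<open>a\<close> and \<open>b\<close>.\<close>
  define \<delta> \<epsilon> where "\<delta> = (cb - ca) / (b - a)" and "\<epsilon> = (db - da) / (b - a)"
  have "h t x = (ca - \<delta> * a) + (da - \<epsilon> * a) * t + (\<delta> + \<epsilon> * t) * x" if tx: "t \<in> T" "x \<in> U" for t x
  proof -
    obtain c d where "\<forall>x\<in>U. h t x = c + d * x" using x[OF tx(1)] by blast
    then have *: "h t x = c + d * x" "c + d * a = ca + da * t" "c + d * b = cb + db * t"
      using A B tx a b by metis+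
    then have "d * (b - a) = (cb - ca) + (db - da) * t" by (simp add: algebra_simps)
    then have "d = ((cb - ca) + (db - da) * t) / (b - a)" using b by (simp add: eq_divide_eq)
    then have "d = \<delta> + \<epsilon> * t" by (simp add: \<delta>_def \<epsilon>_def add_divide_distrib)
    with * show ?thesis by (simp add: algebra_simps)
  qed
  then show ?thesis by blast
qed

text \<open>These maps form a class closed under directional derivatives, so the induction runs with
  the map and all its coefficients arbitrary. The formula is required on \<open>D\<close> only,
  since that is where the derivative of \<open>f\<close> is known.\<close>

lemma C_k_on_quadratic:
  fixes f :: "real \<times> real \<times> real \<Rightarrow> 'b::real_normed_vector"
  assumes "open D"
    and "\<And>t s x. (t, s, x) \<in> D \<Longrightarrow>
      f (t, s, x) = c0 + t *\<^sub>R c1 + s *\<^sub>R c2 + x *\<^sub>R c3 + t\<^sup>2 *\<^sub>R c4 + (t * x) *\<^sub>R c5"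
  shows "C_k_on k D f"
  using assms(2)
proof (induction k arbitrary: f c0 c1 c2 c3 c4 c5)
  case 0
  let ?q = "\<lambda>p. c0 + fst p *\<^sub>R c1 + fst (snd p) *\<^sub>R c2 + snd (snd p) *\<^sub>R c3
    + (fst p)\<^sup>2 *\<^sub>R c4 + (fst p * snd (snd p)) *\<^sub>R c5"
  have "continuous_on D ?q" by (intro continuous_intros)
  then show ?case using 0 by (subst C_k_on.simps, subst continuous_on_cong[of D D f ?q]) auto
next
  case (Suc k)
  let ?q = "\<lambda>p. c0 + fst p *\<^sub>R c1 + fst (snd p) *\<^sub>R c2 + snd (snd p) *\<^sub>R c3
    + (fst p)\<^sup>2 *\<^sub>R c4 + (fst p * snd (snd p)) *\<^sub>R c5"
  let ?d = "\<lambda>p v. fst v *\<^sub>R c1 + fst (snd v) *\<^sub>R c2 + snd (snd v) *\<^sub>R c3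
    + (2 * fst p * fst v) *\<^sub>R c4 + (fst v * snd (snd p) + fst p * snd (snd v)) *\<^sub>R c5"
  have "(?q has_derivative ?d p) (at p)" for p
    by (rule has_derivative_eq_rhs, (rule derivative_intros)+) (auto simp: fun_eq_iff algebra_simps)
  then have d: "(f has_derivative ?d p) (at p)" if "p \<in> D" for p
    by (rule has_derivative_transform_within_open[OF _ \<open>open D\<close> that])
      (auto simp: Suc.prems)
  have "C_k_on k D (\<lambda>p. frechet_derivative f (at p) v)" for v
  proof (rule Suc.IH)
    fix t s x assume "(t, s, x) \<in> D"
    from fun_cong[OF frechet_derivative_at[OF d[OF this]], of v, symmetric]
    show "frechet_derivative f (at (t, s, x)) v =
      (fst v *\<^sub>R c1 + fst (snd v) *\<^sub>R c2 + snd (snd v) *\<^sub>R c3) + t *\<^sub>R ((2 * fst v) *\<^sub>R c4 + snd (snd v) *\<^sub>R c5)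
      + s *\<^sub>R 0 + x *\<^sub>R (fst v *\<^sub>R c5) + t\<^sup>2 *\<^sub>R 0 + (t * x) *\<^sub>R 0"
      by (simp add: algebra_simps)
  qed
  then show ?case unfolding C_k_on.simps differentiable_def using d by blast
qed

section \<open>Sufficiency\<close>

lemma gas_prolongationI:
  assumes "\<gamma> > 1" "open I" "smooth_on I S" "\<forall>s\<in>I. S s > 0" "open T" "open U"
    and "n \<ge> 1 \<longrightarrow> U \<subseteq> {0<..}"
    and "partials2 (T \<times> I \<times> U) (\<lambda>p. fst (X p)) \<tau>' \<tau>''"
    and "partials2 (T \<times> I \<times> U) (\<lambda>p. fst (snd (X p))) \<sigma>' \<sigma>''"
    and "partials2 (T \<times> I \<times> U) (\<lambda>p. snd (snd (X p))) \<eta>' \<eta>''"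
  shows "gas_prolongation T I U X \<tau>' \<sigma>' \<eta>' \<tau>'' \<sigma>'' \<eta>'' n \<gamma> S"
  using assms smooth_on_imp_DERIV[OF assms(3,2)]
  by unfold_locales (auto intro!: open_Times)

section \<open>Derivative data of the explicit fields\<close>

lemma partials2_biaffine:
  "partials2 D (\<lambda>p. \<alpha> + \<beta> * fst p + (\<delta> + \<epsilon> * fst p) * snd (snd p))
    (\<lambda>v p. case v of vt \<Rightarrow> \<beta> + \<epsilon> * snd (snd p) | vs \<Rightarrow> 0 | vu \<Rightarrow> \<delta> + \<epsilon> * fst p)
    (\<lambda>v w p. if v = vt \<and> w = vu \<or> v = vu \<and> w = vt then \<epsilon> else 0)"
  unfolding partials2_def partials_def
proof (intro conjI ballI allI)
  fix p :: "real \<times> real \<times> real"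
  show "((\<lambda>p. \<alpha> + \<beta> * fst p + (\<delta> + \<epsilon> * fst p) * snd (snd p)) has_derivative
    (\<lambda>h. fst h * (case vt of vt \<Rightarrow> \<beta> + \<epsilon> * snd (snd p) | vs \<Rightarrow> 0 | vu \<Rightarrow> \<delta> + \<epsilon> * fst p) +
      fst (snd h) * (case vs of vt \<Rightarrow> \<beta> + \<epsilon> * snd (snd p) | vs \<Rightarrow> 0 | vu \<Rightarrow> \<delta> + \<epsilon> * fst p) +
      snd (snd h) * (case vu of vt \<Rightarrow> \<beta> + \<epsilon> * snd (snd p) | vs \<Rightarrow> 0 | vu \<Rightarrow> \<delta> + \<epsilon> * fst p))) (at p)"
    by (auto intro!: derivative_eq_intros simp: algebra_simps)
  fix v
  show "((\<lambda>p. case v of vt \<Rightarrow> \<beta> + \<epsilon> * snd (snd p) | vs \<Rightarrow> 0 | vu \<Rightarrow> \<delta> + \<epsilon> * fst p) has_derivative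
    (\<lambda>h. fst h * (if v = vt \<and> vt = vu \<or> v = vu \<and> vt = vt then \<epsilon> else 0) +
      fst (snd h) * (if v = vt \<and> vs = vu \<or> v = vu \<and> vs = vt then \<epsilon> else 0) +
      snd (snd h) * (if v = vt \<and> vu = vu \<or> v = vu \<and> vu = vt then \<epsilon> else 0))) (at p)"
    by (cases v) (auto intro!: derivative_eq_intros simp: algebra_simps)
qed

lemma partials2_quadratic_t:
  "partials2 D (\<lambda>p. a + b * fst p + c * (fst p)\<^sup>2)
    (\<lambda>v p. if v = vt then b + 2 * c * fst p else 0) (\<lambda>v w p. if v = vt \<and> w = vt then 2 * c else 0)"
  unfolding partials2_def partials_def
proof (intro conjI ballI allI)
  fix p :: "real \<times> real \<times> real"
  show "((\<lambda>p. a + b * fst p + c * (fst p)\<^sup>2) has_derivative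
    (\<lambda>h. fst h * (if vt = vt then b + 2 * c * fst p else 0) +
      fst (snd h) * (if vs = vt then b + 2 * c * fst p else 0) +
      snd (snd h) * (if vu = vt then b + 2 * c * fst p else 0))) (at p)"
    by (auto intro!: derivative_eq_intros simp: algebra_simps)
  fix v
  show "((\<lambda>p. if v = vt then b + 2 * c * fst p else 0) has_derivative
    (\<lambda>h. fst h * (if v = vt \<and> vt = vt then 2 * c else 0) +
      fst (snd h) * (if v = vt \<and> vs = vt then 2 * c else 0) +
      snd (snd h) * (if v = vt \<and> vu = vt then 2 * c else 0))) (at p)"
    by (cases v) (auto intro!: derivative_eq_intros simp: algebra_simps)
qed

lemma partials2_affine_s:
  "partials2 D (\<lambda>p. a + b * fst (snd p)) (\<lambda>v p. if v = vs then b else 0) (\<lambda>v w p. 0)"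
  unfolding partials2_def partials_def
proof (intro conjI ballI allI)
  fix p :: "real \<times> real \<times> real"
  show "((\<lambda>p. a + b * fst (snd p)) has_derivative
    (\<lambda>h. fst h * (if vt = vs then b else 0) + fst (snd h) * (if vs = vs then b else 0) +
      snd (snd h) * (if vu = vs then b else 0))) (at p)"
    by (auto intro!: derivative_eq_intros simp: algebra_simps)
qed (auto intro!: derivative_eq_intros)

text \<open>Serves both directions: for affine \<sigma> it turns the first equation for S into the
  vanishing of \<open>coeff_1\<close>; for unknown \<sigma> its comparison with
  \<open>coeff_1 = 0\<close> isolates \<sigma>''.\<close>

lemma structure_eq_deriv:
  fixes S S' S'' \<sigma> \<sigma>' \<sigma>'' :: "real \<Rightarrow> real"
  assumes "open I" "s \<in> I" and eq: "\<And>s. s \<in> I \<Longrightarrow> \<sigma> s * S' s = (m + c * \<sigma>' s) * S s"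
    and d: "(S has_real_derivative S' s) (at s)" "(S' has_real_derivative S'' s) (at s)"
      "(\<sigma> has_real_derivative \<sigma>' s) (at s)" "(\<sigma>' has_real_derivative \<sigma>'' s) (at s)"
  shows "\<sigma>' s * S' s + \<sigma> s * S'' s = c * \<sigma>'' s * S s + (m + c * \<sigma>' s) * S' s"
proof -
  have "((\<lambda>s. \<sigma> s * S' s) has_real_derivative \<sigma>' s * S' s + \<sigma> s * S'' s) (at s)"
    using DERIV_mult[OF d(3) d(2)] by (simp add: algebra_simps)
  moreover have "((\<lambda>s. (m + c * \<sigma>' s) * S s) has_real_derivative
      c * \<sigma>'' s * S s + (m + c * \<sigma>' s) * S' s) (at s)"
    by (rule derivative_eq_intros d refl)+ (simp add: algebra_simps)
  then have "((\<lambda>s. \<sigma> s * S' s) has_real_derivative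
      c * \<sigma>'' s * S s + (m + c * \<sigma>' s) * S' s) (at s)"
    by (rule has_field_derivative_transform_within_open[OF _ assms(1,2)]) (simp add: eq)
  ultimately show ?thesis by (rule DERIV_unique)
qed

lemma sum_generators:
  fixes k :: "nat \<Rightarrow> real"
  shows "(\<Sum>i = 1..8. k i *\<^sub>R Y i p) = (k 1 + k 4 * fst p + k 8 * (fst p)\<^sup>2, k 2 + k 5 * fst (snd p),
    k 3 + k 7 * fst p + (k 6 + k 8 * fst p) * snd (snd p))"
proof -
  have "{1..8::nat} = {1, 2, 3, 4, 5, 6, 7, 8}" by auto
  then show ?thesis
    by (cases p) (simp add: Y_def algebra_simps)
qed

lemma symmetry_if:
  fixes n :: nat and \<gamma> :: real and S :: "real \<Rightarrow> real"
    and T I U :: "real set" and X :: vfield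
  assumes "\<gamma> > 1" and "open I" and "smooth_on I S" and "\<forall>s\<in>I. S s > 0"
    and "open T" and "open U" and "n \<ge> 1 \<longrightarrow> U \<subseteq> {0<..}"
    and X: "\<forall>p \<in> T \<times> I \<times> U. X p = (\<Sum>i = 1..8. k i *\<^sub>R Y i p)"
    and S: "\<forall>s\<in>I. (k 5 * s + k 2) * deriv S s =
          (- 2 * k 4 + (1 - \<gamma>) * k 5 + ((real n + 1) * \<gamma> - real n + 1) * k 6) * S s"
    and k: "((real n + 1) * \<gamma> - real n - 3) * k 8 = 0" "real n * k 3 = 0" "real n * k 7 = 0"
  shows "admitted_point_symmetry (T \<times> I \<times> U) (gas_dynamics n \<gamma> S) X"
proof -
  have D: "open (T \<times> I \<times> U)" using assms by (intro open_Times)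
  have Xe: "X p = (k 1 + k 4 * fst p + k 8 * (fst p)\<^sup>2, k 2 + k 5 * fst (snd p),
    k 3 + k 7 * fst p + (k 6 + k 8 * fst p) * snd (snd p))" if "p \<in> T \<times> I \<times> U" for p
    using X[rule_format, OF that] unfolding sum_generators .
  have "smooth_on (T \<times> I \<times> U) X"
    unfolding smooth_on_def
  proof
    show "C_k_on j (T \<times> I \<times> U) X" for j
      by (rule C_k_on_quadratic[OF D, of X "(k 1, k 2, k 3)" "(k 4, 0, k 7)" "(0, k 5, 0)" "(0, 0, k 6)"
        "(k 8, 0, 0)" "(0, 0, k 8)"]) (simp add: Xe algebra_simps)
  qed
  moreover interpret gas_prolongation T I U X
    "\<lambda>v p. if v = vt then k 4 + 2 * k 8 * fst p else 0"
    "\<lambda>v p. if v = vs then k 5 else 0"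
    "\<lambda>v p. case v of vt \<Rightarrow> k 7 + k 8 * snd (snd p) | vs \<Rightarrow> 0 | vu \<Rightarrow> k 6 + k 8 * fst p"
    "\<lambda>v w p. if v = vt \<and> w = vt then 2 * k 8 else 0"
    "\<lambda>v w p. 0"
    "\<lambda>v w p. if v = vt \<and> w = vu \<or> v = vu \<and> w = vt then k 8 else 0" n \<gamma> S
    by (rule gas_prolongationI[OF assms(1-7)];
      rule partials2_cong[OF partials2_quadratic_t D] partials2_cong[OF partials2_affine_s D]
        partials2_cong[OF partials2_biaffine D]) (simp_all add: Xe)
  have symmetric
  proof (rule symmetricI)
    fix P assume "P \<in> T \<times> I \<times> U"
    then obtain t s x where P: "P = (t, s, x)" and t: "t \<in> T" and s: "s \<in> I" and x: "x \<in> U" by auto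
    have XP: "X (t, s, x) = (k 1 + k 4 * t + k 8 * t\<^sup>2, k 2 + k 5 * s, k 3 + k 7 * t + (k 6 + k 8 * t) * x)"
      using Xe[of "(t, s, x)"] t s x by simp
    have nx: "n = 0 \<or> x > 0" using x U_pos by auto
    have b: "real n * (k 3 + k 7 * t) = 0" using k by (auto simp: distrib_left)
    \<comment> \<open>For n = 0 both sides are 0; otherwise the summand free of x vanishes and x > 0
      cancels.\<close>
    have ex: "(k 3 + k 7 * t + (k 6 + k 8 * t) * x) * real n * (1 - \<gamma>) / x = (k 6 + k 8 * t) * real n * (1 - \<gamma>)"
      using b nx by (cases "n = 0") auto
    define a where "a = k 6 + k 8 * t"
    \<comment> \<open>The two occurrences of t combine to ((n+1)\<gamma> - n - 3) k8 t = 0, so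
      \<open>m\<close> is independent of t and is part of the right side of the condition on
      S.\<close>
    define m where "m = - 2 * (k 4 + 2 * k 8 * t) + ((real n + 1) * \<gamma> - real n + 1) * a"
    have N: "(real n + 1) * \<gamma> * k 8 = (real n + 3) * k 8" using k(1) by (simp add: algebra_simps)
    have m: "m = - 2 * k 4 + ((real n + 1) * \<gamma> - real n + 1) * k 6"
      using arg_cong[OF N, of "\<lambda>r. r * t"] by (simp add: m_def a_def algebra_simps)
    have S0: "(k 2 + k 5 * s) * deriv S s = (m + (1 - \<gamma>) * k 5) * S s" if "s \<in> I" for s
      using S[rule_format, OF that] by (simp add: m algebra_simps)
    \<comment> \<open>The derivative of \<open>S0\<close>; the factor 0 is the second derivative of
      the affine function \<open>k 2 + k 5 * s\<close>. Rearranged, this is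
      \<open>coeff_1 P = 0\<close>.\<close>
    have S1: "k 5 * deriv S s + (k 2 + k 5 * s) * deriv (deriv S) s
        = (1 - \<gamma>) * 0 * S s + (m + (1 - \<gamma>) * k 5) * deriv S s"
      by (rule structure_eq_deriv[where \<sigma> = "\<lambda>s. k 2 + k 5 * s" and \<sigma>' = "\<lambda>_. k 5" and \<sigma>'' = "\<lambda>_. 0"
        and S = S and S' = "deriv S" and S'' = "deriv (deriv S)", OF assms(2) s S0 S_DERIV[OF s] S_DERIV2[OF s]])
        (auto intro!: derivative_eq_intros)
    have "coeff_1 P = 0"
      unfolding P coeff_1_def prod.case XP fst_conv snd_conv ex
      using S1 by (simp add: m_def a_def algebra_simps)
    moreover have "coeff_u_ss P = 0"
      unfolding P coeff_u_ss_def prod.case XP fst_conv snd_conv ex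
      using S0[OF s] by (simp add: m_def a_def algebra_simps)
    \<comment> \<open>For n > 0 the quotient of \<eta> by x equals its \<phi>-derivative
      \<open>a\<close>, and \<open>coeff_u_s\<close> becomes n \<gamma> / x times
      \<open>coeff_u_ss\<close>.\<close>
    moreover have "coeff_u_s P = 0"
    proof (cases "n = 0")
      case False
      then have "k 3 = 0" "k 7 = 0" "x > 0" using k nx by auto
      then have xe: "(k 3 + k 7 * t + (k 6 + k 8 * t) * x) / x = a" by (simp add: a_def)
      then show ?thesis
        unfolding P coeff_u_s_def prod.case XP fst_conv snd_conv ex xe
        using S0[OF s] by (simp add: m_def a_def algebra_simps)
    next
      case True
      then show ?thesis unfolding P coeff_u_s_def by simp
    qed
    ultimately show "separated P \<and> coeff_1 P = 0 \<and> coeff_u_ss P = 0 \<and> coeff_u_s P = 0 \<and>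
      (case vs of vt \<Rightarrow> k 7 + k 8 * snd (snd P) | vs \<Rightarrow> 0 | vu \<Rightarrow> k 6 + k 8 * fst P) = 0 \<and>
      (if vs = vt \<and> vs = vu \<or> vs = vu \<and> vs = vt then k 8 else 0) = 0 \<and>
      (if vs = vt \<and> vu = vu \<or> vs = vu \<and> vu = vt then k 8 else 0) = 0 \<and>
      (if vu = vt \<and> vs = vu \<or> vu = vu \<and> vs = vt then k 8 else 0) = 0 \<and>
      (if vt = vt \<and> vt = vu \<or> vt = vu \<and> vt = vt then k 8 else 0) = 0 \<and>
      (if vu = vt \<and> vu = vu \<or> vu = vu \<and> vu = vt then k 8 else 0) = 0 \<and>
      (if vt = vt \<and> vu = vu \<or> vt = vu \<and> vu = vt then k 8 else 0) +
      (if vu = vt \<and> vt = vu \<or> vu = vu \<and> vt = vt then k 8 else 0) =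
      (if vt = vt \<and> vt = vt then 2 * k 8 else 0)"
      by (simp add: separated_def)
  qed
  ultimately show ?thesis
    by (auto simp: admitted_point_symmetry_def symmetric_def)
qed

section \<open>Necessity\<close>

text \<open>\<open>G1\<close>, \<open>G2\<close> and \<open>G3\<close> describe one vector field by
  increasingly frozen derivative data: the Frechet derivatives; then those of
  \<open>\<xi>\<^sup>t\<close> along t and of \<open>\<xi>\<^sup>s\<close> along s; then also those
  of \<eta> on the slice s = s0. What one description proves about the field justifies the next
  through \<open>partials2_cong\<close>.\<close>

lemma admitted_imp_separated_form:
  fixes n :: nat and \<gamma> :: real and S :: "real \<Rightarrow> real"
    and T I U :: "real set" and X :: vfield
  assumes "\<gamma> > 1" and I: "open I" and "smooth_on I S" and "\<forall>s\<in>I. S s > 0"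
    and T: "open T" and U: "open U" and npos: "n \<ge> 1 \<longrightarrow> U \<subseteq> {0<..}"
    and ivl: "is_interval T" "is_interval I" "is_interval U" and ne: "T \<noteq> {}" "I \<noteq> {}" "U \<noteq> {}"
    and adm: "admitted_point_symmetry (T \<times> I \<times> U) (gas_dynamics n \<gamma> S) X"
  obtains \<tau> \<tau>' \<tau>'' \<sigma> \<sigma>' \<sigma>'' \<alpha> \<beta> \<delta> \<epsilon> where
    "\<And>t. t \<in> T \<Longrightarrow> (\<tau> has_real_derivative \<tau>' t) (at t)"
    "\<And>t. t \<in> T \<Longrightarrow> (\<tau>' has_real_derivative \<tau>'' t) (at t)"
    "\<And>s. s \<in> I \<Longrightarrow> (\<sigma> has_real_derivative \<sigma>' s) (at s)"
    "\<And>s. s \<in> I \<Longrightarrow> (\<sigma>' has_real_derivative \<sigma>'' s) (at s)"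
    "\<And>t s x. t \<in> T \<Longrightarrow> s \<in> I \<Longrightarrow> x \<in> U \<Longrightarrow> X (t, s, x) = (\<tau> t, \<sigma> s, \<alpha> + \<beta> * t + (\<delta> + \<epsilon> * t) * x)"
    "gas_prolongation T I U X (\<lambda>v p. if v = vt then \<tau>' (fst p) else 0)
      (\<lambda>v p. if v = vs then \<sigma>' (fst (snd p)) else 0)
      (\<lambda>v p. case v of vt \<Rightarrow> \<beta> + \<epsilon> * snd (snd p) | vs \<Rightarrow> 0 | vu \<Rightarrow> \<delta> + \<epsilon> * fst p)
      (\<lambda>v w p. if v = vt \<and> w = vt then \<tau>'' (fst p) else 0)
      (\<lambda>v w p. if v = vs \<and> w = vs then \<sigma>'' (fst (snd p)) else 0)
      (\<lambda>v w p. if v = vt \<and> w = vu \<or> v = vu \<and> w = vt then \<epsilon> else 0) n \<gamma> S"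
proof -
  let ?D = "T \<times> I \<times> U"
  have D: "open ?D" using T I U by (intro open_Times)
  obtain t0 s0 x0 where t0: "t0 \<in> T" and s0: "s0 \<in> I" and x0: "x0 \<in> U" using ne by blast
  have smooth: "smooth_on ?D X" using adm by (simp add: admitted_point_symmetry_def)
  obtain \<tau>1 \<tau>2 where pt: "partials2 ?D (\<lambda>p. fst (X p)) \<tau>1 \<tau>2"
    using smooth_on_imp_partials2[OF smooth bounded_linear_fst] by blast
  obtain \<sigma>1 \<sigma>2 where ps: "partials2 ?D (\<lambda>p. fst (snd (X p))) \<sigma>1 \<sigma>2"
    using smooth_on_imp_partials2[OF smooth bounded_linear_compose[OF bounded_linear_fst bounded_linear_snd]]
    by blast
  obtain \<eta>1 \<eta>2 where pe: "partials2 ?D (\<lambda>p. snd (snd (X p))) \<eta>1 \<eta>2"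
    using smooth_on_imp_partials2[OF smooth bounded_linear_compose[OF bounded_linear_snd bounded_linear_snd]]
    by blast
  note gpI = gas_prolongationI[OF assms(1-7)]
  note conds = adm[unfolded admitted_point_symmetry_def, THEN conjunct2]
  interpret G1: gas_prolongation T I U X \<tau>1 \<sigma>1 \<eta>1 \<tau>2 \<sigma>2 \<eta>2 n \<gamma> S
    by (rule gpI[OF pt ps pe])
  have sym1: "G1.symmetric" unfolding G1.symmetric_def by (rule conds)
  have z: "\<tau>1 vs p = 0" "\<tau>1 vu p = 0" "\<sigma>1 vt p = 0" "\<sigma>1 vu p = 0" if "p \<in> ?D" for p
    using G1.symmetric_u_ts_coeff[OF sym1] that by (cases p; simp)+
  have pt1: "partials ?D (\<lambda>p. fst (X p)) \<tau>1" and ps1: "partials ?D (\<lambda>p. fst (snd (X p))) \<sigma>1"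
    and pe1: "partials ?D (\<lambda>p. snd (snd (X p))) \<eta>1" using pt ps pe by (auto simp: partials2_def)
  have Xt: "fst (X (t, s, x)) = fst (X (t, s0, x0))" if "t \<in> T" "s \<in> I" "x \<in> U" for t s x
    using slice_constant(2)[OF pt1 ivl that(1) t0 that(2) s0 that(3) x0]
      slice_constant(3)[OF pt1 ivl that(1) t0 s0 s0 that(3) x0] z by metis
  have Xs: "fst (snd (X (t, s, x))) = fst (snd (X (t0, s, x0)))" if "t \<in> T" "s \<in> I" "x \<in> U" for t s x
    using slice_constant(1)[OF ps1 ivl that(1) t0 that(2) s0 that(3) x0]
      slice_constant(3)[OF ps1 ivl t0 t0 that(2) s0 that(3) x0] z by metis
  have pt': "partials2 ?D (\<lambda>p. fst (X p)) (\<lambda>v p. if v = vt then \<tau>1 vt (fst p, s0, x0) else 0)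
    (\<lambda>v w p. if v = vt \<and> w = vt then \<tau>2 vt vt (fst p, s0, x0) else 0)"
    by (rule partials2_cong[OF partials2_t_slice[OF pt s0 x0] D]) (use Xt in auto)
  have ps': "partials2 ?D (\<lambda>p. fst (snd (X p))) (\<lambda>v p. if v = vs then \<sigma>1 vs (t0, fst (snd p), x0) else 0)
    (\<lambda>v w p. if v = vs \<and> w = vs then \<sigma>2 vs vs (t0, fst (snd p), x0) else 0)"
    by (rule partials2_cong[OF partials2_s_slice[OF ps t0 x0] D]) (use Xs in auto)
  interpret G2: gas_prolongation T I U X "\<lambda>v p. if v = vt then \<tau>1 vt (fst p, s0, x0) else 0"
    "\<lambda>v p. if v = vs then \<sigma>1 vs (t0, fst (snd p), x0) else 0" \<eta>1
    "\<lambda>v w p. if v = vt \<and> w = vt then \<tau>2 vt vt (fst p, s0, x0) else 0"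
    "\<lambda>v w p. if v = vs \<and> w = vs then \<sigma>2 vs vs (t0, fst (snd p), x0) else 0" \<eta>2 n \<gamma> S
    by (rule gpI[OF pt' ps' pe])
  have sym2: "G2.symmetric" unfolding G2.symmetric_def by (rule conds)
  have sep2: "G2.separated p" for p by (simp add: G2.separated_def)
  have e: "\<eta>2 vu vu p = 0" "\<eta>1 vs p = 0" if "p \<in> ?D" for p
    using G2.symmetric_coeffs[OF sym2 that sep2] by auto
  have Xe: "snd (snd (X (t, s, x))) = snd (snd (X (t, s0, x)))" if "t \<in> T" "s \<in> I" "x \<in> U" for t s x
    by (rule slice_constant(2)[OF pe1 ivl that(1) t0 that(2) s0 that(3) x0]) (rule e)
  \<comment> \<open>All derivatives of \<eta> that involve s are now 0 by definition, in either
    order; this meets the hypotheses of \<open>symmetric_coeffs_s_independent\<close>.\<close>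
  have pe': "partials2 ?D (\<lambda>p. snd (snd (X p)))
    (\<lambda>v p. if v = vs then 0 else \<eta>1 v (fst p, s0, snd (snd p)))
    (\<lambda>v w p. if v = vs \<or> w = vs then 0 else \<eta>2 v w (fst p, s0, snd (snd p)))"
    by (rule partials2_cong[OF partials2_tu_slice[OF pe s0] D]) (use Xe in auto)
  interpret G3: gas_prolongation T I U X "\<lambda>v p. if v = vt then \<tau>1 vt (fst p, s0, x0) else 0"
    "\<lambda>v p. if v = vs then \<sigma>1 vs (t0, fst (snd p), x0) else 0"
    "\<lambda>v p. if v = vs then 0 else \<eta>1 v (fst p, s0, snd (snd p))"
    "\<lambda>v w p. if v = vt \<and> w = vt then \<tau>2 vt vt (fst p, s0, x0) else 0"
    "\<lambda>v w p. if v = vs \<and> w = vs then \<sigma>2 vs vs (t0, fst (snd p), x0) else 0"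
    "\<lambda>v w p. if v = vs \<or> w = vs then 0 else \<eta>2 v w (fst p, s0, snd (snd p))" n \<gamma> S
    by (rule gpI[OF pt' ps' pe'])
  have sym3: "G3.symmetric" unfolding G3.symmetric_def by (rule conds)
  have sep3: "G3.separated p" for p by (simp add: G3.separated_def)
  \<comment> \<open>The slice s = s0 is enough, because \<eta> does not depend on s by
    \<open>Xe\<close>.\<close>
  have e3: "\<eta>2 vt vt (t, s0, x) = 0" if "t \<in> T" "x \<in> U" for t x
    using G3.symmetric_coeffs_s_independent(1)[OF sym3 _ sep3, of "(t, s0, x)"] that s0 by simp
  note De = partials_DERIV[OF pe1]
  have De2: "partials ?D (\<eta>1 v) (\<eta>2 v)" for v using pe by (simp add: partials2_def)
  have "\<exists>\<alpha> \<beta> \<delta> \<epsilon>. \<forall>t\<in>T. \<forall>x\<in>U. snd (snd (X (t, s0, x))) = \<alpha> + \<beta> * t + (\<delta> + \<epsilon> * t) * x"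
  proof (rule affine_in_each_imp_biaffine[OF U ne(3)])
    fix x assume x: "x \<in> U"
    have "\<exists>c d. \<forall>t\<in>T. snd (snd (X (t, s0, x))) = c + d * t \<and> \<eta>1 vt (t, s0, x) = d"
      by (rule DERIV2_zero_imp_affine[OF ivl(1) De(1)])
        (use x s0 partials_DERIV(1)[OF De2, of _ s0 x vt] e3[OF _ x] in auto)
    then show "\<exists>c d. \<forall>t\<in>T. snd (snd (X (t, s0, x))) = c + d * t" by blast
  next
    fix t assume t: "t \<in> T"
    have "\<exists>c d. \<forall>x\<in>U. snd (snd (X (t, s0, x))) = c + d * x \<and> \<eta>1 vu (t, s0, x) = d"
      by (rule DERIV2_zero_imp_affine[OF ivl(3) De(3)])
        (use t s0 partials_DERIV(3)[OF De2, of t s0 _ vu] e(1) in auto)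
    then show "\<exists>c d. \<forall>x\<in>U. snd (snd (X (t, s0, x))) = c + d * x" by blast
  qed
  then obtain \<alpha> \<beta> \<delta> \<epsilon> where
    bi: "\<And>t x. t \<in> T \<Longrightarrow> x \<in> U \<Longrightarrow> snd (snd (X (t, s0, x))) = \<alpha> + \<beta> * t + (\<delta> + \<epsilon> * t) * x"
    by blast
  have pe'': "partials2 ?D (\<lambda>p. snd (snd (X p)))
    (\<lambda>v p. case v of vt \<Rightarrow> \<beta> + \<epsilon> * snd (snd p) | vs \<Rightarrow> 0 | vu \<Rightarrow> \<delta> + \<epsilon> * fst p)
    (\<lambda>v w p. if v = vt \<and> w = vu \<or> v = vu \<and> w = vt then \<epsilon> else 0)"
    by (rule partials2_cong[OF partials2_biaffine D]) (use Xe bi in force)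
  have "(\<lambda>v. partials ?D (\<tau>1 v) (\<tau>2 v)) vt" "(\<lambda>v. partials ?D (\<sigma>1 v) (\<sigma>2 v)) vs"
    using pt ps by (auto simp: partials2_def)
  then have "partials ?D (\<tau>1 vt) (\<tau>2 vt)" "partials ?D (\<sigma>1 vs) (\<sigma>2 vs)" by simp_all
  note d2 = partials_DERIV(1)[OF this(1)] partials_DERIV(2)[OF this(2)]
  show thesis
  proof (rule that)
    show "((\<lambda>t. fst (X (t, s0, x0))) has_real_derivative \<tau>1 vt (t, s0, x0)) (at t)" if "t \<in> T" for t
      using partials_DERIV(1)[OF pt1] that s0 x0 by simp
    show "((\<lambda>t. \<tau>1 vt (t, s0, x0)) has_real_derivative \<tau>2 vt vt (t, s0, x0)) (at t)" if "t \<in> T" for t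
      using d2(1) that s0 x0 by simp
    show "((\<lambda>s. fst (snd (X (t0, s, x0)))) has_real_derivative \<sigma>1 vs (t0, s, x0)) (at s)" if "s \<in> I" for s
      using partials_DERIV(2)[OF ps1] that t0 x0 by simp
    show "((\<lambda>s. \<sigma>1 vs (t0, s, x0)) has_real_derivative \<sigma>2 vs vs (t0, s, x0)) (at s)" if "s \<in> I" for s
      using d2(2) that t0 x0 by simp
    show "X (t, s, x) = (fst (X (t, s0, x0)), fst (snd (X (t0, s, x0))), \<alpha> + \<beta> * t + (\<delta> + \<epsilon> * t) * x)"
      if "t \<in> T" "s \<in> I" "x \<in> U" for t s x
      using Xt[OF that] Xs[OF that] Xe[OF that] bi[OF that(1,3)] by (simp add: prod_eq_iff)
  qed (rule gpI[OF pt' ps' pe''])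
qed

lemma symmetry_only_if:
  fixes n :: nat and \<gamma> :: real and S :: "real \<Rightarrow> real"
    and T I U :: "real set" and X :: vfield
  assumes gamma: "\<gamma> > 1" and I: "open I" and "smooth_on I S" and Spos: "\<forall>s\<in>I. S s > 0"
    and T: "open T" and U: "open U" and npos: "n \<ge> 1 \<longrightarrow> U \<subseteq> {0<..}"
    and ivl: "is_interval T" "is_interval I" "is_interval U" and ne: "T \<noteq> {}" "I \<noteq> {}" "U \<noteq> {}"
    and adm: "admitted_point_symmetry (T \<times> I \<times> U) (gas_dynamics n \<gamma> S) X"
  obtains k where "\<forall>p \<in> T \<times> I \<times> U. X p = (\<Sum>i = 1..8. k i *\<^sub>R Y i p)"
    "\<forall>s\<in>I. (k 5 * s + k 2) * deriv S s =
          (- 2 * k 4 + (1 - \<gamma>) * k 5 + ((real n + 1) * \<gamma> - real n + 1) * k 6) * S s"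
    "((real n + 1) * \<gamma> - real n - 3) * k 8 = 0" "real n * k 3 = 0" "real n * k 7 = 0"
proof -
  obtain \<tau> \<tau>' \<tau>'' \<sigma> \<sigma>' \<sigma>'' \<alpha> \<beta> \<delta> \<epsilon> where
    \<tau>: "\<And>t. t \<in> T \<Longrightarrow> (\<tau> has_real_derivative \<tau>' t) (at t)"
    "\<And>t. t \<in> T \<Longrightarrow> (\<tau>' has_real_derivative \<tau>'' t) (at t)"
    and \<sigma>: "\<And>s. s \<in> I \<Longrightarrow> (\<sigma> has_real_derivative \<sigma>' s) (at s)"
    "\<And>s. s \<in> I \<Longrightarrow> (\<sigma>' has_real_derivative \<sigma>'' s) (at s)"
    and X: "\<And>t s x. t \<in> T \<Longrightarrow> s \<in> I \<Longrightarrow> x \<in> U \<Longrightarrow> X (t, s, x) = (\<tau> t, \<sigma> s, \<alpha> + \<beta> * t + (\<delta> + \<epsilon> * t) * x)"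
    and G: "gas_prolongation T I U X (\<lambda>v p. if v = vt then \<tau>' (fst p) else 0)
      (\<lambda>v p. if v = vs then \<sigma>' (fst (snd p)) else 0)
      (\<lambda>v p. case v of vt \<Rightarrow> \<beta> + \<epsilon> * snd (snd p) | vs \<Rightarrow> 0 | vu \<Rightarrow> \<delta> + \<epsilon> * fst p)
      (\<lambda>v w p. if v = vt \<and> w = vt then \<tau>'' (fst p) else 0)
      (\<lambda>v w p. if v = vs \<and> w = vs then \<sigma>'' (fst (snd p)) else 0)
      (\<lambda>v w p. if v = vt \<and> w = vu \<or> v = vu \<and> w = vt then \<epsilon> else 0) n \<gamma> S"
    using admitted_imp_separated_form[OF assms] by blast
  interpret gas_prolongation T I U X "\<lambda>v p. if v = vt then \<tau>' (fst p) else 0"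
      "\<lambda>v p. if v = vs then \<sigma>' (fst (snd p)) else 0"
      "\<lambda>v p. case v of vt \<Rightarrow> \<beta> + \<epsilon> * snd (snd p) | vs \<Rightarrow> 0 | vu \<Rightarrow> \<delta> + \<epsilon> * fst p"
      "\<lambda>v w p. if v = vt \<and> w = vt then \<tau>'' (fst p) else 0"
      "\<lambda>v w p. if v = vs \<and> w = vs then \<sigma>'' (fst (snd p)) else 0"
      "\<lambda>v w p. if v = vt \<and> w = vu \<or> v = vu \<and> w = vt then \<epsilon> else 0" n \<gamma> S
    by (rule G)
  obtain t0 s0 x0 where t0: "t0 \<in> T" and s0: "s0 \<in> I" and x0: "x0 \<in> U" using ne by blast
  have sym: symmetric unfolding symmetric_def by (rule adm[unfolded admitted_point_symmetry_def, THEN conjunct2])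
  have sep: "separated p" for p by (simp add: separated_def)
  define N where "N = (real n + 1) * \<gamma> - real n + 1"
  have coeffs: "\<tau>'' t = 2 * \<epsilon>"
    "S s * (\<delta> + \<epsilon> * t - 2 * \<tau>' t) - \<sigma> s * deriv S s
      - (\<alpha> + \<beta> * t + (\<delta> + \<epsilon> * t) * x) * real n * (1 - \<gamma>) / x * S s
      + (\<gamma> + 1) * (\<delta> + \<epsilon> * t - \<sigma>' s) * S s - (\<delta> + \<epsilon> * t - 2 * \<sigma>' s) * S s = 0"
    "deriv S s * (2 * \<tau>' t - (\<delta> + \<epsilon> * t)) + \<sigma> s * deriv (deriv S) s
      + (\<alpha> + \<beta> * t + (\<delta> + \<epsilon> * t) * x) * real n * (1 - \<gamma>) / x * deriv S s
      - \<gamma> * (\<delta> + \<epsilon> * t - \<sigma>' s) * deriv S s + \<gamma> * \<sigma>'' s * S s = 0"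
    if "t \<in> T" "s \<in> I" "x \<in> U" for t s x
  proof -
    have P: "(t, s, x) \<in> T \<times> I \<times> U" using that by simp
    from symmetric_coeffs(2)[OF sym P sep] show "\<tau>'' t = 2 * \<epsilon>" by simp
    from symmetric_coeffs(4)[OF sym P sep] show
      "S s * (\<delta> + \<epsilon> * t - 2 * \<tau>' t) - \<sigma> s * deriv S s
      - (\<alpha> + \<beta> * t + (\<delta> + \<epsilon> * t) * x) * real n * (1 - \<gamma>) / x * S s
      + (\<gamma> + 1) * (\<delta> + \<epsilon> * t - \<sigma>' s) * S s - (\<delta> + \<epsilon> * t - 2 * \<sigma>' s) * S s = 0"
      unfolding coeff_u_ss_def prod.case X[OF that] by simp
    from symmetric_coeffs_s_independent(2)[OF sym P sep] show
      "deriv S s * (2 * \<tau>' t - (\<delta> + \<epsilon> * t)) + \<sigma> s * deriv (deriv S) s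
      + (\<alpha> + \<beta> * t + (\<delta> + \<epsilon> * t) * x) * real n * (1 - \<gamma>) / x * deriv S s
      - \<gamma> * (\<delta> + \<epsilon> * t - \<sigma>' s) * deriv S s + \<gamma> * \<sigma>'' s * S s = 0"
      unfolding coeff_1_def prod.case X[OF that] by simp
  qed
  \<comment> \<open>In \<open>coeff_u_ss\<close> only n(1-\<gamma>)(\<alpha> + \<beta> t)/x depends
    on x. Its values at two points of \<open>U\<close> must agree.\<close>
  have nb: "real n * (\<alpha> + \<beta> * t) = 0" if t: "t \<in> T" for t
  proof (cases "n = 0")
    case False
    obtain x1 where x1: "x1 \<in> U" "x1 \<noteq> x0" using open_obtain_other[OF U x0] .
    have x: "x0 > 0" "x1 > 0" using False npos x0 x1 by auto
    let ?r = "\<lambda>x. (\<alpha> + \<beta> * t + (\<delta> + \<epsilon> * t) * x) * real n * (1 - \<gamma>) / x"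
    have "?r x0 * S s0 = ?r x1 * S s0"
      using coeffs(2)[OF t s0 x0] coeffs(2)[OF t s0 x1(1)] by linarith
    moreover have "S s0 \<noteq> 0" using Spos s0 by force
    ultimately have "?r x0 = ?r x1" using mult_right_cancel by blast
    then have "real n * (1 - \<gamma>) * (\<alpha> + \<beta> * t) * (x1 - x0) = 0"
      using x by (simp add: field_simps)
    then show ?thesis using gamma x1 by simp
  qed simp
  have n3: "real n * \<alpha> = 0" and n7: "real n * \<beta> = 0"
  proof -
    obtain t1 where "t1 \<in> T" "t1 \<noteq> t0" using open_obtain_other[OF T t0] .
    moreover have "real n * \<beta> * (t1 - t0) = real n * (\<alpha> + \<beta> * t1) - real n * (\<alpha> + \<beta> * t0)"
      by (simp add: right_diff_distrib distrib_left)
    ultimately show "real n * \<beta> = 0" using nb[OF t0] nb[of t1] by simp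
    then show "real n * \<alpha> = 0" using nb[OF t0] by (auto simp: distrib_left)
  qed
  have frac: "(\<alpha> + \<beta> * t + (\<delta> + \<epsilon> * t) * x) * real n * (1 - \<gamma>) / x = (\<delta> + \<epsilon> * t) * real n * (1 - \<gamma>)"
    if "t \<in> T" "x \<in> U" for t x
    using npos that n3 n7 by (cases "n = 0") auto
  have eq: "\<sigma> s * deriv S s = ((- 2 * \<tau>' t + N * (\<delta> + \<epsilon> * t)) + (1 - \<gamma>) * \<sigma>' s) * S s"
    if "t \<in> T" "s \<in> I" for t s
    using coeffs(2)[OF that x0] unfolding frac[OF that(1) x0] N_def by (simp add: algebra_simps)
  \<comment> \<open>Both equations express \<sigma> S''. Differentiating \<open>eq\<close>
    contributes (1-\<gamma>) \<sigma>'' S and \<open>coeff_1 = 0\<close> contributes -\<gamma>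
    \<sigma>'' S; the remaining terms coincide, so the difference is S \<sigma>''.\<close>
  have \<sigma>'': "\<sigma>'' s = 0" if s: "s \<in> I" for s
  proof -
    have "S s * \<sigma>'' s = 0"
      using structure_eq_deriv[of I s \<sigma> "deriv S" _ _ \<sigma>' S "deriv (deriv S)" \<sigma>'', OF I s eq[OF t0] S_DERIV[OF s] S_DERIV2[OF s] \<sigma>(1)[OF s] \<sigma>(2)[OF s]]
        coeffs(3)[OF t0 s x0]
      unfolding frac[OF t0 x0] N_def by (simp add: algebra_simps)
    then show ?thesis using Spos s by auto
  qed
  obtain k2 k5 where k25: "\<forall>s\<in>I. \<sigma> s = k2 + k5 * s \<and> \<sigma>' s = k5"
    using DERIV2_zero_imp_affine[OF ivl(2) \<sigma>(1)] \<sigma>(2) \<sigma>'' by metis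
  \<comment> \<open>Since \<tau>'' = 2 \<epsilon>, subtracting \<epsilon> t squared leaves a
    function with vanishing second derivative.\<close>
  have "\<exists>c d. \<forall>t\<in>T. \<tau> t - \<epsilon> * t\<^sup>2 = c + d * t \<and> \<tau>' t - 2 * \<epsilon> * t = d"
    by (rule DERIV2_zero_imp_affine[OF ivl(1)])
      (auto intro!: derivative_eq_intros \<tau> simp: coeffs(1)[OF _ s0 x0])
  then obtain k1 k4 where k14: "\<And>t. t \<in> T \<Longrightarrow> \<tau> t = k1 + k4 * t + \<epsilon> * t\<^sup>2"
    "\<And>t. t \<in> T \<Longrightarrow> \<tau>' t = k4 + 2 * \<epsilon> * t"
    by (metis add_diff_cancel_left' diff_add_cancel)
  have S: "(k2 + k5 * s) * deriv S s =
      ((- 2 * k4 + N * \<delta> + (N - 4) * \<epsilon> * t) + (1 - \<gamma>) * k5) * S s"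
    if "t \<in> T" "s \<in> I" for t s
    using eq[OF that] k25 k14(2)[OF that(1)] that(2) by (simp add: algebra_simps)
  \<comment> \<open>The left side of \<open>S\<close> is independent of t, so its right side takes
    the same value at two times, and S > 0 cancels.\<close>
  have n8: "(N - 4) * \<epsilon> = 0"
  proof -
    obtain t1 where t1: "t1 \<in> T" "t1 \<noteq> t0" using open_obtain_other[OF T t0] .
    have "((- 2 * k4 + N * \<delta> + (N - 4) * \<epsilon> * t0) + (1 - \<gamma>) * k5) * S s0
      = ((- 2 * k4 + N * \<delta> + (N - 4) * \<epsilon> * t1) + (1 - \<gamma>) * k5) * S s0"
      using S[OF t0 s0] S[OF t1(1) s0] by (rule trans[OF HOL.sym])
    then have "(N - 4) * \<epsilon> * t0 = (N - 4) * \<epsilon> * t1" using Spos s0 by auto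
    then show ?thesis using t1 by simp
  qed
  \<comment> \<open>The leading 0 fills index 0, because the generators are numbered from 1.\<close>
  define k where "k i = [0, k1, k2, \<alpha>, k4, k5, \<delta>, \<beta>, \<epsilon>] ! i" for i :: nat
  have kv: "k 1 = k1" "k 2 = k2" "k 3 = \<alpha>" "k 4 = k4" "k 5 = k5" "k 6 = \<delta>" "k 7 = \<beta>" "k 8 = \<epsilon>"
    by (simp_all add: k_def)
  show thesis
  proof (rule that[of k])
    show "\<forall>p \<in> T \<times> I \<times> U. X p = (\<Sum>i = 1..8. k i *\<^sub>R Y i p)"
      unfolding sum_generators kv using X k14(1) k25 by auto
    show "\<forall>s\<in>I. (k 5 * s + k 2) * deriv S s =
          (- 2 * k 4 + (1 - \<gamma>) * k 5 + ((real n + 1) * \<gamma> - real n + 1) * k 6) * S s"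
      unfolding kv N_def[symmetric] using S[OF t0, unfolded n8] by (simp add: ac_simps)
    show "((real n + 1) * \<gamma> - real n - 3) * k 8 = 0"
      using n8 unfolding kv N_def by (simp add: algebra_simps)
    show "real n * k 3 = 0" "real n * k 7 = 0" unfolding kv by (fact n3 n7)+
  qed
qed

theorem mainTheorem1:
  fixes n :: nat and \<gamma> :: real and S :: "real \<Rightarrow> real"
    and T I U :: "real set" and X :: vfield
  assumes "n \<in> {0, 1, 2}" and "\<gamma> > 1"
    and "open I" and "is_interval I" and "I \<noteq> {}"
    and "smooth_on I S" and "\<forall>s\<in>I. S s > 0"
    and "open T" and "is_interval T" and "T \<noteq> {}"
    and "open U" and "is_interval U" and "U \<noteq> {}"
    and "n \<ge> 1 \<longrightarrow> U \<subseteq> {0<..}"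
  shows "admitted_point_symmetry (T \<times> I \<times> U) (gas_dynamics n \<gamma> S) X \<longleftrightarrow>
    (\<exists>k :: nat \<Rightarrow> real.
       (\<forall>p \<in> T \<times> I \<times> U. X p = (\<Sum>i = 1..8. k i *\<^sub>R Y i p)) \<and>
       (\<forall>s\<in>I. (k 5 * s + k 2) * deriv S s =
          (- 2 * k 4 + (1 - \<gamma>) * k 5 + ((real n + 1) * \<gamma> - real n + 1) * k 6) * S s) \<and>
       ((real n + 1) * \<gamma> - real n - 3) * k 8 = 0 \<and>
       real n * k 3 = 0 \<and>
       real n * k 7 = 0)"
    (is "?adm \<longleftrightarrow> ?form")
proof
  assume ?adm
  show ?form
    by (rule symmetry_only_if[OF assms(2,3,6,7,8,11,14,9,4,12,10,5,13) \<open>?adm\<close>], intro exI conjI) assumption+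
next
  assume ?form
  then show ?adm
    by (elim exE conjE, intro symmetry_if[OF assms(2,3,6,7,8,11,14)])
qed

end
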